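(* Let $\rho>1$, let $f$ be analytic inside and on the Bernstein ellipse $\mathcal{E}_\rho$, and let $M=\max_{z\in\mathcal{E}_\rho}|f(z)|$. Let $\lambda>0$. Then for every $n\ge1$, \[ |a_n^\lambda|\le\begin{cases}\Lambda(n,\rho,\lambda)\left(1-\frac{1}{\rho^2}\right)^{\lambda-1}\dfrac{n^{1-\lambda}}{\rho^{n+1}}, & 0<\lambda\le1,\\[2mm] \Lambda(n,\rho,\lambda)\left(1+\frac{1}{\rho^2}\right)^{\lambda-1}\dfrac{n^{1-\lambda}}{\rho^{n+1}}, & \lambda>1,\end{cases} \] where \[ \Lambda(n,\rho,\lambda)=\frac{\Gamma(\lambda)M\Upsilon_n^{1,\lambda}}{\pi}\left[2\left(\rho+\frac1\rho\right)+2\left(\frac\pi2-1\right)\left(\rho-\frac1\rho\right)\right], \] and $\Upsilon_n^{a,b}=\exp\!\left(\frac{a-b}{2(n+b-1)}+\frac{1}{12(n+a-1)}+\frac{(a-1)(a-b)}{n}\right)$.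
   Context: $C_n^{(\lambda)}$ is the Gegenbauer polynomial normalized by $C_n^{(\lambda)}(1)=\Gamma(n+2\lambda)/(n!\,\Gamma(2\lambda))$, orthogonal on $[-1,1]$ with weight $(1-x^2)^{\lambda-1/2}$, with $h_n^{(\lambda)}=\frac{2^{1-2\lambda}\pi}{\Gamma(\lambda)^2}\frac{\Gamma(n+2\lambda)}{\Gamma(n+1)(n+\lambda)}$ its squared weighted norm; the Gegenbauer coefficients of $f$ are $a_n^{\lambda}=\frac{1}{h_n^{(\lambda)}}\int_{-1}^1(1-x^2)^{\lambda-1/2}f(x)C_n^{(\lambda)}(x)\,dx$. $\mathcal{E}_\rho=\{\tfrac12(\rho e^{i\theta}+\rho^{-1}e^{-i\theta}):0\le\theta\le2\pi\}$. *)

theory Defs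
  imports "HOL-Analysis.Analysis"
begin

text \<open>Gegenbauer polynomials via the standard three-term recurrence;
  this gives C_n(1) = Gamma(n+2 lambda)/(n! Gamma(2 lambda)).\<close>
fun gegenbauer :: "nat \<Rightarrow> real \<Rightarrow> real \<Rightarrow> real" where
  "gegenbauer 0 lam x = 1"
| "gegenbauer (Suc 0) lam x = 2 * lam * x"
| "gegenbauer (Suc (Suc n)) lam x =
     (2 * x * (real (Suc n) + lam) * gegenbauer (Suc n) lam x
      - (real (Suc n) + 2 * lam - 1) * gegenbauer n lam x) / real (Suc (Suc n))"

definition gegenbauer_norm :: "nat \<Rightarrow> real \<Rightarrow> real" where
  "gegenbauer_norm n lam =
     (2 powr (1 - 2 * lam) * pi / (Gamma lam)\<^sup>2) *
     (Gamma (real n + 2 * lam) / (Gamma (real n + 1) * (real n + lam)))"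

definition gegenbauer_coeff :: "(complex \<Rightarrow> complex) \<Rightarrow> real \<Rightarrow> nat \<Rightarrow> complex" where
  "gegenbauer_coeff f lam n =
     integral {-1..1} (\<lambda>x::real. complex_of_real ((1 - x\<^sup>2) powr (lam - 1/2) * gegenbauer n lam x)
                                  * f (complex_of_real x))
     / complex_of_real (gegenbauer_norm n lam)"

definition bernstein_ellipse :: "real \<Rightarrow> complex set" where
  "bernstein_ellipse rho =
     (\<lambda>\<theta>. (complex_of_real rho * cis \<theta> + complex_of_real (1 / rho) * cis (- \<theta>)) / 2) ` {0..2*pi}"

definition bernstein_region :: "real \<Rightarrow> complex set" where
  "bernstein_region rho = {z. cmod (z - 1) + cmod (z + 1) \<le> rho + 1 / rho}"

definition Upsilon :: "nat \<Rightarrow> real \<Rightarrow> real \<Rightarrow> real" where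
  "Upsilon n a b = exp ((a - b) / (2 * (real n + b - 1)) + 1 / (12 * (real n + a - 1))
                        + (a - 1) * (a - b) / real n)"

definition Lambda_bound :: "nat \<Rightarrow> real \<Rightarrow> real \<Rightarrow> real \<Rightarrow> real" where
  "Lambda_bound n rho lam M =
     Gamma lam * M * Upsilon n 1 lam / pi *
     (2 * (rho + 1 / rho) + 2 * (pi / 2 - 1) * (rho - 1 / rho))"

end

theory Submission
  imports Defs "HOL-Complex_Analysis.Complex_Analysis" "HOL-Real_Asymp.Real_Asymp"
begin

text \<open>
  Put \<open>u = \<rho> e\<^sup>i\<^sup>\<theta>\<close>, \<open>z = (u + 1/u)/2\<close>. Cauchy's formula on the ellipse and the Poisson kernel
  expansion of \<open>1/(z - x)\<close> in powers of \<open>q = 1/u\<close> give a Chebyshev expansion of \<open>f\<close> on \<open>[-1,1]\<close>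
  whose coefficients are the means of \<open>f(z) q\<^sup>k\<close>. Integrating it against the Gegenbauer weight
  brings in the moments of \<open>T\<^sub>k\<close> against \<open>C\<^sub>n\<close>; they have a closed form, and summing them against
  \<open>q\<^sup>k\<close> yields \<open>q\<^sup>n (1 - q\<^sup>2)\<close> times a hypergeometric series
  \<open>F(n + 1, 1 - \<lambda>; n + \<lambda> + 1; q\<^sup>2)\<close>. Euler's integral writes this series as a weighted mean of
  \<open>(1 - t q\<^sup>2)\<close> to the power \<open>\<lambda> - 1\<close>, which gives the factor depending on the sign of \<open>\<lambda> - 1\<close>.
  Since \<open>\<bar>1 - q\<^sup>2\<bar>\<close> is proportional to the speed of the ellipse, what remains is its length, bounded
  through \<open>sqrt (a\<^sup>2 s\<^sup>2 + b\<^sup>2 (1 - s\<^sup>2)) \<le> a \<bar>s\<bar> + b (1 - \<bar>s\<bar>)\<close>, and a Stirling-type estimate of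
  \<open>\<Gamma>(n + 1) / \<Gamma>(n + \<lambda>)\<close>.
\<close>

section \<open>A Stirling bound for Gamma ratios\<close>

text \<open>With \<open>y = 1 / (2 * x + 1)\<close> the logarithm is the odd series 2 (y + y^3/3 +
  ...). Its first term contributes exactly 1 to the product with \<open>x + 1/2\<close>, and a
  geometric majorant of the rest collapses to a telescoping difference.\<close>

lemma stirling_step_bounds:
  fixes x :: real
  assumes "x > 0"
  defines "d \<equiv> (x + 1/2) * ln ((x + 1) / x) - 1"
  shows "d \<ge> 0" and "d \<le> 1 / (12 * x) - 1 / (12 * (x + 1))"
proof -
  define y where "y = 1 / (2 * x + 1)"
  have y: "((x + 1) / x - 1) / ((x + 1) / x + 1) = y"
    using assms(1) by (simp add: y_def field_simps)
  have *: "ln ((x + 1) / x) \<in> {2 * y .. 2 * y + 2 * (y^3 / (1 - y\<^sup>2) / 3)}"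
    using ln_approx_bounds[of "(x + 1) / x" 1] assms(1) unfolding y by (simp add: eval_nat_numeral)
  have xy: "(x + 1/2) * (2 * y) = 1"
    using assms(1) by (simp add: y_def field_simps)
  have pos: "x + 1/2 > 0" using assms(1) by simp
  have "(x + 1/2) * (2 * y) \<le> (x + 1/2) * ln ((x + 1) / x)"
    using * pos by (intro mult_left_mono) auto
  then show "d \<ge> 0" using xy by (simp add: d_def)
  have "(x + 1/2) * ln ((x + 1) / x) \<le> (x + 1/2) * (2 * y + 2 * (y^3 / (1 - y\<^sup>2) / 3))"
    using * pos by (intro mult_left_mono) auto
  also have "\<dots> = 1 + y\<^sup>2 / (1 - y\<^sup>2) / 3"
    using xy by (simp add: algebra_simps power3_eq_cube power2_eq_square)
  also have "y\<^sup>2 / (1 - y\<^sup>2) = 1 / (4 * x * (x + 1))"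
  proof -
    have "((2 * x + 1) * y)\<^sup>2 = 1" using assms(1) by (simp add: y_def)
    then have "1 - y\<^sup>2 = 4 * x * (x + 1) * y\<^sup>2"
      by (simp add: algebra_simps power2_eq_square)
    moreover have "y \<noteq> 0" using assms(1) by (simp add: y_def)
    ultimately show ?thesis by simp
  qed
  also have "1 / (4 * x * (x + 1)) / 3 = 1 / (12 * x) - 1 / (12 * (x + 1))"
    using assms(1) by (simp add: field_simps)
  finally show "d \<le> 1 / (12 * x) - 1 / (12 * (x + 1))" by (simp add: d_def)
qed

text \<open>The error in Stirling's formula with the constant ln(2 pi)/2 left in. That constant is
  never evaluated, because only differences of defects are compared.\<close>

definition stirling_defect :: "real \<Rightarrow> real" where
  "stirling_defect x = ln_Gamma (x + 1) - (x + 1/2) * ln x + x"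

lemma ln_Gamma_real_plus1:
  fixes x :: real
  assumes "x > 0"
  shows "ln_Gamma (x + 1) = ln_Gamma x + ln x"
proof -
  have "x \<notin> \<int>\<^sub>\<le>\<^sub>0" using assms nonpos_Ints_nonpos[of x] by auto
  from Gamma_plus1[OF this] show ?thesis
    using assms Gamma_real_pos[of x] by (simp add: ln_Gamma_real_pos ln_mult less_imp_neq[symmetric])
qed

lemma stirling_defect_diff:
  assumes "x > 0"
  shows "stirling_defect x - stirling_defect (x + 1) = (x + 1/2) * ln ((x + 1) / x) - 1"
  using assms ln_Gamma_real_plus1[of "x + 1"]
  by (simp add: stirling_defect_def ln_div algebra_simps)

text \<open>\<open>ln_Gamma_series x N\<close> is the logarithm of Euler's product N^x N! / (x (x+1)
  ... (x+N)), and the functional equation applied N + 1 times produces the same denominator. Since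
  the right side tends to 0, this gives the growth of Gamma along x + N.\<close>

lemma ln_Gamma_shift_series:
  fixes x :: real
  assumes "x > 0" "N > 0"
  shows "ln_Gamma (x + real N + 1) - ln (fact N) - x * ln (real N) = ln_Gamma x - ln_Gamma_series x N"
proof -
  have "ln_Gamma (x + real N + 1) = ln_Gamma x + ln x + (\<Sum>k=1..N. ln (x / real k + 1)) + ln (fact N)" for N
  proof (induction N)
    case 0
    then show ?case using assms ln_Gamma_real_plus1[of x] by simp
  next
    case (Suc N)
    have "x / real (Suc N) + 1 = (x + real N + 1) / real (Suc N)"
      by (simp add: field_simps)
    moreover have "x + real N + 1 > 0" using assms by simp
    ultimately have "ln (x / real (Suc N) + 1) = ln (x + real N + 1) - ln (real (Suc N))"
      by (simp add: ln_div)
    moreover have "ln (fact (Suc N) :: real) = ln (real (Suc N)) + ln (fact N)"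
      by (simp add: ln_mult)
    moreover have "ln_Gamma (x + real (Suc N) + 1) = ln_Gamma (x + real N + 1) + ln (x + real N + 1)"
      using ln_Gamma_real_plus1[of "x + real N + 1"] assms by (simp add: algebra_simps)
    ultimately show ?case using Suc.IH by simp
  qed
  then show ?thesis by (simp add: ln_Gamma_series_def)
qed

lemma stirling_defect_shift_LIMSEQ:
  fixes x y :: real
  assumes "x > 0" "y > 0"
  shows "(\<lambda>N. stirling_defect (x + real N) - stirling_defect (y + real N)) \<longlonglongrightarrow> 0"
proof -
  define L where "L x N = ln_Gamma x - ln_Gamma_series x N" for x :: real and N
  have L: "L x \<longlonglongrightarrow> 0" if "x > 0" for x
    using tendsto_diff[OF tendsto_const ln_Gamma_real_LIMSEQ[OF that], of "ln_Gamma x"]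
    by (simp add: L_def[abs_def])
  \<comment> \<open>The defect at \<open>x + real N\<close> is \<open>L x N + E x N\<close> plus ln
    N! - (N + 1/2) ln N + N. The last part does not involve x and cancels in the difference.\<close>
  define E where "E x N = x * ln (real N) - (x + real N + 1/2) * ln (x + real N) + x + (real N + 1/2) * ln (real N)"
    for x :: real and N
  have E: "E x \<longlonglongrightarrow> 0" if "x > 0" for x
    unfolding E_def[abs_def] using that by real_asymp
  have "(\<lambda>N. (L x N + E x N) - (L y N + E y N)) \<longlonglongrightarrow> (0 + 0) - (0 + 0)"
    using L E assms by (intro tendsto_intros) auto
  then have lim: "(\<lambda>N. (L x N + E x N) - (L y N + E y N)) \<longlonglongrightarrow> 0" by simp
  show ?thesis
  proof (rule Lim_transform_eventually[OF lim])
    show "\<forall>\<^sub>F N in sequentially. (L x N + E x N) - (L y N + E y N)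
              = stirling_defect (x + real N) - stirling_defect (y + real N)"
      using eventually_gt_at_top[of 0]
      by eventually_elim
        (use ln_Gamma_shift_series assms in \<open>simp add: L_def E_def stirling_defect_def flip: ln_Gamma_shift_series\<close>)
  qed
qed

text \<open>A unit shift lowers the defect at x by at most the telescoping step and does not raise
  the one at y. Hence \<open>D\<close> increases, and as its limit is 0 it starts at or below
  0.\<close>

lemma stirling_defect_compare:
  fixes x y :: real
  assumes "x > 0" "y > 0"
  shows "stirling_defect x - stirling_defect y \<le> 1 / (12 * x)"
proof -
  define D where "D N = stirling_defect (x + real N) - stirling_defect (y + real N) - 1 / (12 * (x + real N))" for N
  have "incseq D"
  proof (rule incseq_SucI)
    fix N
    show "D N \<le> D (Suc N)"
      using stirling_defect_diff[of "x + real N"] stirling_defect_diff[of "y + real N"]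
        stirling_step_bounds[of "x + real N"] stirling_step_bounds[of "y + real N"] assms
      by (simp add: D_def add_ac)
  qed
  moreover have "D \<longlonglongrightarrow> 0 - 0"
    unfolding D_def[abs_def]
    by (intro tendsto_diff stirling_defect_shift_LIMSEQ assms) (use assms in real_asymp)
  ultimately have "D 0 \<le> 0" using incseq_le[of D 0 0] by simp
  then show ?thesis by (simp add: D_def)
qed

text \<open>Stirling is applied at x = n and y = n + lam - 1. The inequality ln u <= u - 1 at u =
  x/y yields the first term of the exponent in \<open>Upsilon\<close>, the comparison of defects
  yields 1/(12 n), and the third term vanishes at a = 1.\<close>

lemma Gamma_ratio_le_Upsilon:
  assumes "lam > 0" "n \<ge> 1"
  shows "Gamma (real n + 1) / Gamma (real n + lam) \<le> Upsilon n 1 lam * real n powr (1 - lam)"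
proof -
  define x y where "x = real n" and "y = real n + lam - 1"
  have x: "x > 0" and y: "y > 0" using assms by (auto simp: x_def y_def)
  have "ln (x / y) \<le> x / y - 1" using x y by (intro ln_le_minus_one) auto
  also have "x / y - 1 = (1 - lam) / y" using y by (simp add: x_def y_def field_simps)
  finally have "(y + 1/2) * ln (x / y) \<le> (y + 1/2) * ((1 - lam) / y)"
    using y by (intro mult_left_mono) auto
  also have "\<dots> = (1 - lam) + (1 - lam) / (2 * y)" using y by (simp add: field_simps)
  finally have "(y + 1/2) * (ln x - ln y) \<le> (1 - lam) + (1 - lam) / (2 * y)"
    using x y by (simp add: ln_div)
  moreover have "ln_Gamma (x + 1) - ln_Gamma (y + 1)
      = stirling_defect x - stirling_defect y + (x - y) * ln x + (y + 1/2) * (ln x - ln y) - (x - y)"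
    by (simp add: stirling_defect_def algebra_simps) (simp add: field_simps)
  moreover have "x - y = 1 - lam" by (simp add: x_def y_def)
  ultimately have "ln_Gamma (x + 1) - ln_Gamma (y + 1)
      \<le> (1 - lam) / (2 * y) + 1 / (12 * x) + (1 - lam) * ln x"
    using stirling_defect_compare[OF x y] by simp
  then have "exp (ln_Gamma (x + 1)) / exp (ln_Gamma (y + 1))
      \<le> exp ((1 - lam) / (2 * y) + 1 / (12 * x)) * exp ((1 - lam) * ln x)"
    by (simp flip: exp_diff exp_add)
  moreover have "exp (ln_Gamma (x + 1)) = Gamma (x + 1)" "exp (ln_Gamma (y + 1)) = Gamma (y + 1)"
    using x y by (simp_all add: Gamma_real_pos_exp)
  ultimately show ?thesis
    using x by (simp add: x_def y_def Upsilon_def powr_def)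
qed

text \<open>The speed of an ellipse with semi-axes a and b is replaced by a function linear in
  \<open>\<bar>s\<bar>\<close>, so that an elementary integral takes the place of an elliptic one.
  The two sides agree at \<open>\<bar>s\<bar>\<close> = 0 and 1.\<close>

lemma ellipse_speed_le:
  fixes a b s :: real
  assumes "0 \<le> b" "b \<le> a" "\<bar>s\<bar> \<le> 1"
  shows "sqrt (a\<^sup>2 * s\<^sup>2 + b\<^sup>2 * (1 - s\<^sup>2)) \<le> a * \<bar>s\<bar> + b * (1 - \<bar>s\<bar>)"
proof (rule real_le_lsqrt)
  define t where "t = \<bar>s\<bar>"
  have t: "0 \<le> t" "t \<le> 1" "s\<^sup>2 = t\<^sup>2" using assms by (auto simp: t_def)
  have "(a * t + b * (1 - t))\<^sup>2 - (a\<^sup>2 * t\<^sup>2 + b\<^sup>2 * (1 - t\<^sup>2)) = 2 * b * (a - b) * t * (1 - t)"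
    by (simp add: algebra_simps power2_eq_square)
  also have "\<dots> \<ge> 0" using t assms by auto
  finally show "a\<^sup>2 * s\<^sup>2 + b\<^sup>2 * (1 - s\<^sup>2) \<le> (a * \<bar>s\<bar> + b * (1 - \<bar>s\<bar>))\<^sup>2"
    by (simp add: t_def)
  show "0 \<le> a * \<bar>s\<bar> + b * (1 - \<bar>s\<bar>)" using assms by auto
qed

section \<open>Chebyshev moments of Gegenbauer polynomials\<close>

text \<open>The Chebyshev polynomial T_k on [-1,1] in trigonometric form, so that its bound and its
  product formulas are cosine identities. Outside the interval it has no such meaning.\<close>

definition cheb :: "nat \<Rightarrow> real \<Rightarrow> real" where
  "cheb k x = cos (real k * arccos x)"

lemma cheb_0 [simp]: "cheb 0 x = 1"
  by (simp add: cheb_def)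

lemma abs_cheb_le_1: "\<bar>cheb k x\<bar> \<le> 1"
  by (simp add: cheb_def)

lemma continuous_on_cheb [continuous_intros]: "continuous_on {-1..1} (cheb k)"
  unfolding cheb_def by (intro continuous_intros continuous_on_arccos) auto

lemma cheb_mult_x:
  assumes "x \<in> {-1..1}"
  shows "2 * x * cheb (Suc k) x = cheb (Suc (Suc k)) x + cheb k x"
proof -
  define t where "t = arccos x"
  have x: "x = cos t" using assms by (simp add: t_def)
  have "cos (real (Suc (Suc k)) * t) + cos (real k * t) = 2 * cos (real (Suc k) * t) * cos t"
    using cos_add[of "real (Suc k) * t" t] cos_diff[of "real (Suc k) * t" t]
    by (simp add: algebra_simps)
  then show ?thesis unfolding cheb_def t_def[symmetric] by (subst x) (simp add: mult_ac)
qed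

lemma cheb_1:
  assumes "x \<in> {-1..1}"
  shows "cheb (Suc 0) x = x"
  using assms by (simp add: cheb_def)

lemma has_derivative_cheb:
  assumes "x \<in> {-1<..<1}"
  shows "(cheb k has_real_derivative real k * sin (real k * arccos x) / sqrt (1 - x\<^sup>2)) (at x)"
  unfolding cheb_def using assms
  by (auto intro!: derivative_eq_intros simp: field_simps)

section \<open>The Gegenbauer weight: total mass and integrability\<close>

definition gegenbauer_weight :: "real \<Rightarrow> real \<Rightarrow> real" where
  "gegenbauer_weight lam x = (1 - x\<^sup>2) powr (lam - 1/2)"

lemma gegenbauer_weight_nonneg: "gegenbauer_weight lam x \<ge> 0"
  by (simp add: gegenbauer_weight_def)

lemma Gamma_legendre_duplication_real:
  fixes x :: real
  assumes "x > 0"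
  shows "Gamma x * Gamma (x + 1/2) = 2 powr (1 - 2 * x) * sqrt pi * Gamma (2 * x)"
proof -
  have "complex_of_real x \<notin> \<int>\<^sub>\<le>\<^sub>0" "complex_of_real x + 1/2 \<notin> \<int>\<^sub>\<le>\<^sub>0"
    using assms by (auto elim!: nonpos_Ints_cases simp: complex_eq_iff)
  from Gamma_legendre_duplication[OF this]
  have "complex_of_real (Gamma x * Gamma (x + 1/2)) =
          complex_of_real (exp ((1 - 2 * x) * ln 2) * sqrt pi * Gamma (2 * x))"
    by (simp flip: Gamma_complex_of_real exp_of_real)
  then show ?thesis unfolding of_real_eq_iff by (simp add: powr_def)
qed

text \<open>The substitution t = (x + 1)/2 gives 4 t (1 - t) = 1 - x^2 and hence a Beta integral
  with equal arguments. Legendre duplication brings its value to the form of the norm.\<close>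

lemma has_integral_gegenbauer_weight:
  assumes "lam > 0"
  shows "(gegenbauer_weight lam has_integral gegenbauer_norm 0 lam) {-1..1}"
proof -
  define B where "B = Beta (lam + 1/2) (lam + 1/2)"
  have "((\<lambda>t. t powr (lam - 1/2) * (1 - t) powr (lam - 1/2)) has_integral B) (cbox 0 (1::real))"
    using has_integral_Beta_real[of "lam + 1/2" "lam + 1/2"] assms by (simp add: B_def)
  from has_integral_affinity'[OF this, of "1/2" "1/2"]
  have "((\<lambda>x. ((1/2) *\<^sub>R x + 1/2) powr (lam - 1/2) * (1 - ((1/2) *\<^sub>R x + 1/2)) powr (lam - 1/2))
          has_integral 2 * B) {-1..1::real}"
    by simp
  then have "((\<lambda>x. 4 powr (lam - 1/2) * (((1/2) *\<^sub>R x + 1/2) powr (lam - 1/2)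
      * (1 - ((1/2) *\<^sub>R x + 1/2)) powr (lam - 1/2))) has_integral 4 powr (lam - 1/2) * (2 * B)) {-1..1::real}"
    by (rule has_integral_mult_right)
  moreover have "4 powr (lam - 1/2) * (((1/2) *\<^sub>R x + 1/2) powr (lam - 1/2)
      * (1 - ((1/2) *\<^sub>R x + 1/2)) powr (lam - 1/2)) = gegenbauer_weight lam x"
    if "x \<in> {-1..1}" for x :: real
  proof -
    have "((1/2) *\<^sub>R x + 1/2) powr (lam - 1/2) * (1 - ((1/2) *\<^sub>R x + 1/2)) powr (lam - 1/2)
        = (((1/2) *\<^sub>R x + 1/2) * (1 - ((1/2) *\<^sub>R x + 1/2))) powr (lam - 1/2)"
      using that by (subst powr_mult) auto
    also have "4 powr (lam - 1/2) * \<dots> = (4 * (((1/2) *\<^sub>R x + 1/2) * (1 - ((1/2) *\<^sub>R x + 1/2)))) powr (lam - 1/2)"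
      using that by (subst powr_mult) auto
    also have "4 * (((1/2) *\<^sub>R x + 1/2) * (1 - ((1/2) *\<^sub>R x + 1/2))) = 1 - x\<^sup>2"
      by (simp add: field_simps power2_eq_square)
    finally show ?thesis by (simp add: gegenbauer_weight_def)
  qed
  ultimately have "(gegenbauer_weight lam has_integral 4 powr (lam - 1/2) * (2 * B)) {-1..1}"
    by (rule has_integral_eq[rotated])
  moreover have "4 powr (lam - 1/2) * (2 * B) = gegenbauer_norm 0 lam"
  proof -
    have pos: "Gamma lam > 0" "Gamma (2 * lam) > 0" using assms by auto
    have "Gamma (lam + 1/2) = 2 powr (1 - 2 * lam) * sqrt pi * Gamma (2 * lam) / Gamma lam"
      using Gamma_legendre_duplication_real[OF assms] pos by (simp add: field_simps)
    moreover have "Gamma (2 * lam + 1) = 2 * lam * Gamma (2 * lam)"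
      using Gamma_plus1[of "2 * lam"] assms nonpos_Ints_nonpos[of "2 * lam"] by force
    ultimately have "B = (2 powr (1 - 2 * lam) * sqrt pi * Gamma (2 * lam) / Gamma lam)\<^sup>2 / (2 * lam * Gamma (2 * lam))"
      by (simp add: B_def Beta_def power2_eq_square algebra_simps)
    also have "\<dots> = (2 powr (1 - 2 * lam))\<^sup>2 * pi * Gamma (2 * lam) / ((Gamma lam)\<^sup>2 * 2 * lam)"
      using pos by (simp add: field_simps power2_eq_square)
    finally have "4 powr (lam - 1/2) * (2 * B) =
        (4 powr (lam - 1/2) * (2 powr (1 - 2 * lam))) * (2 powr (1 - 2 * lam) * pi * Gamma (2 * lam) / ((Gamma lam)\<^sup>2 * lam))"
      by (simp add: field_simps power2_eq_square)
    also have "(4::real) powr (lam - 1/2) * (2 powr (1 - 2 * lam)) = 1"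
      using powr_powr[of 2 2 "lam - 1/2"] by (simp add: algebra_simps flip: powr_add)
    finally show ?thesis by (simp add: gegenbauer_norm_def algebra_simps)
  qed
  ultimately show ?thesis by simp
qed

lemma absolutely_integrable_weight_mult:
  fixes g :: "real \<Rightarrow> 'a::euclidean_space"
  assumes "lam > 0" "continuous_on {-1..1} g"
  shows "(\<lambda>x. gegenbauer_weight lam x *\<^sub>R g x) absolutely_integrable_on {-1..1}"
proof -
  have "gegenbauer_weight lam absolutely_integrable_on {-1..1}"
    using has_integral_gegenbauer_weight[OF assms(1)] gegenbauer_weight_nonneg
    by (intro nonnegative_absolutely_integrable_1) (auto simp: has_integral_integrable)
  then show ?thesis
    using assms(2)
    by (intro absolutely_integrable_bounded_measurable_product[where h = "\<lambda>y w. w *\<^sub>R y"])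
       (auto intro!: continuous_imp_measurable_on_sets_lebesgue compact_imp_bounded compact_continuous_image
          simp: bilinear_conv_bounded_bilinear bounded_bilinear.flip[OF bounded_bilinear_scaleR])
qed

lemma continuous_on_gegenbauer [continuous_intros]: "continuous_on A (gegenbauer n lam)"
proof (induction n rule: less_induct)
  case (less n)
  show ?case
  proof (cases n)
    case (Suc m)
    then show ?thesis
    proof (cases m)
      case (Suc k)
      then show ?thesis using less[of k] less[of "Suc k"] \<open>n = Suc m\<close>
        by (auto intro!: continuous_intros)
    qed (auto intro!: continuous_intros)
  qed (auto intro!: continuous_intros)
qed

section \<open>Recurrences for the moments\<close>

definition cheb_moment :: "real \<Rightarrow> nat \<Rightarrow> nat \<Rightarrow> real" where
  "cheb_moment lam n k = integral {-1..1} (\<lambda>x. gegenbauer_weight lam x * (gegenbauer n lam x * cheb k x))"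

lemma weight_integrable:
  fixes g :: "real \<Rightarrow> real"
  assumes "lam > 0" "continuous_on {-1..1} g"
  shows "(\<lambda>x. gegenbauer_weight lam x * g x) integrable_on {-1..1}"
  using absolutely_integrable_weight_mult[OF assms] by (simp add: set_lebesgue_integral_eq_integral(1))

text \<open>Carries a pointwise linear relation over to weighted integrals. Three terms suffice for
  every recurrence below; shorter ones are padded with terms of coefficient 0.\<close>

lemma weight_integral_lincomb:
  fixes g g1 g2 g3 :: "real \<Rightarrow> real"
  assumes "lam > 0" "continuous_on {-1..1} g1" "continuous_on {-1..1} g2" "continuous_on {-1..1} g3"
    and "\<And>x. x \<in> {-1..1} \<Longrightarrow> a * g x = c1 * g1 x + c2 * g2 x + c3 * g3 x"
  defines "I \<equiv> \<lambda>g. integral {-1..1} (\<lambda>x. gegenbauer_weight lam x * g x)"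
  shows "a * I g = c1 * I g1 + c2 * I g2 + c3 * I g3"
proof -
  let ?w = "gegenbauer_weight lam"
  have "a * I g = integral {-1..1} (\<lambda>x. a * (?w x * g x))" by (simp add: I_def)
  also have "\<dots> = integral {-1..1} (\<lambda>x. c1 * (?w x * g1 x) + c2 * (?w x * g2 x) + c3 * (?w x * g3 x))"
  proof (rule integral_cong)
    fix x :: real assume "x \<in> {-1..1}"
    then have "a * (?w x * g x) = ?w x * (c1 * g1 x + c2 * g2 x + c3 * g3 x)"
      using assms(5)[of x] by (metis mult.left_commute)
    then show "a * (?w x * g x) = c1 * (?w x * g1 x) + c2 * (?w x * g2 x) + c3 * (?w x * g3 x)"
      by (simp add: algebra_simps)
  qed
  also have "\<dots> = c1 * I g1 + c2 * I g2 + c3 * I g3"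
  proof -
    have "((\<lambda>x. ?w x * h x) has_integral I h) {-1..1}" if "continuous_on {-1..1} h" for h
      using weight_integrable[OF assms(1) that] by (simp add: I_def integrable_integral)
    then show ?thesis
      using assms(2-4) by (intro integral_unique has_integral_add has_integral_mult_right)
  qed
  finally show ?thesis .
qed

lemma gegenbauer_Suc_Suc:
  "real (n + 2) * gegenbauer (Suc (Suc n)) lam x =
     2 * x * (real n + 1 + lam) * gegenbauer (Suc n) lam x - (real n + 2 * lam) * gegenbauer n lam x"
  by (simp add: field_simps)

text \<open>The three-term recurrence of C_n contains a factor 2 x, which is moved onto T and split
  there into two neighbours. Together with the three lemmas that follow, this determines all moments
  from those with n = 0.\<close>

lemma cheb_moment_recurrence:
  assumes "lam > 0"
  shows "real (n + 2) * cheb_moment lam (Suc (Suc n)) (Suc k) =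
     (real n + 1 + lam) * cheb_moment lam (Suc n) (Suc (Suc k))
      + (real n + 1 + lam) * cheb_moment lam (Suc n) k
      + (- (real n + 2 * lam)) * cheb_moment lam n (Suc k)"
  unfolding cheb_moment_def
proof (rule weight_integral_lincomb)
  fix x :: real assume x: "x \<in> {-1..1}"
  have "real (n + 2) * (gegenbauer (Suc (Suc n)) lam x * cheb (Suc k) x)
     = (real n + 1 + lam) * gegenbauer (Suc n) lam x * (2 * x * cheb (Suc k) x)
        - (real n + 2 * lam) * gegenbauer n lam x * cheb (Suc k) x"
    unfolding mult.assoc[symmetric] gegenbauer_Suc_Suc by (simp add: algebra_simps)
  then show "real (n + 2) * (gegenbauer (Suc (Suc n)) lam x * cheb (Suc k) x) =
      (real n + 1 + lam) * (gegenbauer (Suc n) lam x * cheb (Suc (Suc k)) x)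
       + (real n + 1 + lam) * (gegenbauer (Suc n) lam x * cheb k x)
       + (- (real n + 2 * lam)) * (gegenbauer n lam x * cheb (Suc k) x)"
    unfolding cheb_mult_x[OF x] by (simp add: algebra_simps)
qed (use assms in \<open>auto intro!: continuous_intros simp del: gegenbauer.simps\<close>)

lemma cheb_moment_recurrence_0:
  assumes "lam > 0"
  shows "real (n + 2) * cheb_moment lam (Suc (Suc n)) 0 =
     (2 * (real n + 1 + lam)) * cheb_moment lam (Suc n) (Suc 0)
      + (- (real n + 2 * lam)) * cheb_moment lam n 0 + 0 * cheb_moment lam 0 0"
  unfolding cheb_moment_def
proof (rule weight_integral_lincomb)
  fix x :: real assume x: "x \<in> {-1..1}"
  show "real (n + 2) * (gegenbauer (Suc (Suc n)) lam x * cheb 0 x) =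
      (2 * (real n + 1 + lam)) * (gegenbauer (Suc n) lam x * cheb (Suc 0) x)
       + (- (real n + 2 * lam)) * (gegenbauer n lam x * cheb 0 x) + 0 * (gegenbauer 0 lam x * cheb 0 x)"
    unfolding mult.assoc[symmetric] gegenbauer_Suc_Suc using x by (simp add: cheb_1 algebra_simps)
qed (use assms in \<open>auto intro!: continuous_intros simp del: gegenbauer.simps\<close>)

lemma cheb_moment_1:
  assumes "lam > 0"
  shows "1 * cheb_moment lam (Suc 0) (Suc k) =
     lam * cheb_moment lam 0 (Suc (Suc k)) + lam * cheb_moment lam 0 k + 0 * cheb_moment lam 0 0"
  unfolding cheb_moment_def
proof (rule weight_integral_lincomb)
  fix x :: real assume x: "x \<in> {-1..1}"
  show "1 * (gegenbauer (Suc 0) lam x * cheb (Suc k) x) =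
      lam * (gegenbauer 0 lam x * cheb (Suc (Suc k)) x) + lam * (gegenbauer 0 lam x * cheb k x)
        + 0 * (gegenbauer 0 lam x * cheb 0 x)"
    using arg_cong[OF cheb_mult_x[OF x, of k], of "\<lambda>y. lam * y"] by (simp add: algebra_simps)
qed (use assms in \<open>auto intro!: continuous_intros\<close>)

lemma cheb_moment_1_0:
  assumes "lam > 0"
  shows "1 * cheb_moment lam (Suc 0) 0 =
     (2 * lam) * cheb_moment lam 0 (Suc 0) + 0 * cheb_moment lam 0 0 + 0 * cheb_moment lam 0 0"
  unfolding cheb_moment_def
  by (rule weight_integral_lincomb) (use assms in \<open>auto intro!: continuous_intros simp: cheb_1\<close>)

text \<open>The integrand is the derivative of (1 - x^2)^(lam + 1/2) T_m, which vanishes at both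
  endpoints. Since sin(arccos x) is the square root of 1 - x^2, one root in the derivative of T_m is
  absorbed.\<close>

lemma has_integral_cheb_derivative:
  assumes "lam > 0"
  shows "((\<lambda>x. gegenbauer_weight lam x * (- (2 * lam + 1) * x * cheb m x
            + real m * (sin (arccos x) * sin (real m * arccos x)))) has_integral 0) {-1..1}"
proof -
  define F where "F x = (1 - x\<^sup>2) powr (lam + 1/2) * cheb m x" for x
  have "((\<lambda>x. gegenbauer_weight lam x * (- (2 * lam + 1) * x * cheb m x
            + real m * (sin (arccos x) * sin (real m * arccos x)))) has_integral F 1 - F (-1)) {-1..1}"
  \<comment> \<open>The interior form is required: \<open>arccos\<close> is not differentiable at
    the endpoints and the weight may be singular there.\<close>
  proof (rule fundamental_theorem_of_calculus_interior)
    show "continuous_on {-1..1} F"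
    proof -
      have "\<forall>x\<in>{-1..1::real}. 0 \<le> 1 - x\<^sup>2 \<and> (1 - x\<^sup>2 = 0 \<longrightarrow> 0 < lam + 1/2)"
      proof
        fix x :: real assume "x \<in> {-1..1}"
        then have "x\<^sup>2 \<le> 1" by (simp add: abs_square_le_1 abs_le_iff)
        then show "0 \<le> 1 - x\<^sup>2 \<and> (1 - x\<^sup>2 = 0 \<longrightarrow> 0 < lam + 1/2)" using assms by simp
      qed
      then have "continuous_on {-1..1} (\<lambda>x. (1 - x\<^sup>2) powr (lam + 1/2))"
        by (intro continuous_on_powr' continuous_intros)
      then show ?thesis
        unfolding F_def by (intro continuous_on_mult continuous_on_cheb)
    qed
  next
    fix x :: real assume x: "x \<in> {-1<..<1}"
    define s where "s = 1 - x\<^sup>2"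
    have s: "s > 0" using x by (auto simp: s_def power2_less_1_iff abs_less_iff)
    have "(F has_real_derivative s powr (lam + 1/2) * (real m * sin (real m * arccos x) / sqrt s)
          + ((lam + 1/2) * s powr (lam - 1/2) * (- 2 * x)) * cheb m x) (at x)"
      unfolding F_def using s x
      by (auto intro!: derivative_eq_intros has_derivative_cheb simp: s_def)
    also have "s powr (lam + 1/2) = s powr (lam - 1/2) * sqrt s * sqrt s"
      using s by (simp add: powr_half_sqrt[symmetric] flip: powr_add)
    also have "s powr (lam - 1/2) * sqrt s * sqrt s * (real m * sin (real m * arccos x) / sqrt s)
          + ((lam + 1/2) * s powr (lam - 1/2) * (- 2 * x)) * cheb m x
       = s powr (lam - 1/2) * (- (2 * lam + 1) * x * cheb m x + real m * (sqrt s * sin (real m * arccos x)))"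
      using s by (simp add: algebra_simps)
    also have "sqrt s = sin (arccos x)" using x by (simp add: sin_arccos s_def)
    finally show "(F has_vector_derivative gegenbauer_weight lam x * (- (2 * lam + 1) * x * cheb m x
            + real m * (sin (arccos x) * sin (real m * arccos x)))) (at x)"
      by (simp add: has_real_derivative_iff_has_vector_derivative gegenbauer_weight_def s_def)
  qed auto
  then show ?thesis by (simp add: F_def)
qed

lemma cheb_moment_0_1:
  assumes "lam > 0"
  shows "cheb_moment lam 0 (Suc 0) = 0"
proof -
  have "1 * cheb_moment lam 0 (Suc 0) = (- (1 / (2 * lam + 1))) *
       integral {-1..1} (\<lambda>x. gegenbauer_weight lam x * (- (2 * lam + 1) * x * cheb 0 x
            + real 0 * (sin (arccos x) * sin (real 0 * arccos x))))
        + 0 * cheb_moment lam 0 0 + 0 * cheb_moment lam 0 0"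
    unfolding cheb_moment_def
    by (rule weight_integral_lincomb) (use assms in \<open>auto intro!: continuous_intros simp: cheb_1 field_simps\<close>)
  then show ?thesis using has_integral_cheb_derivative[OF assms, of 0] by (simp add: integral_unique)
qed

text \<open>The vanishing derivative integral at m = k + 1, multiplied by -2. Both x T_{k+1} and the
  product of sines become combinations of T_k and T_{k+2}, whose coefficients are collected.\<close>

lemma cheb_moment_0_recurrence:
  assumes "lam > 0"
  shows "(real k + 2 + 2 * lam) * cheb_moment lam 0 (Suc (Suc k)) = (real k - 2 * lam) * cheb_moment lam 0 k"
proof -
  have "(real k + 2 + 2 * lam) * cheb_moment lam 0 (Suc (Suc k)) = (real k - 2 * lam) * cheb_moment lam 0 k
       + (- 2) * integral {-1..1} (\<lambda>x. gegenbauer_weight lam x * (- (2 * lam + 1) * x * cheb (Suc k) x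
            + real (Suc k) * (sin (arccos x) * sin (real (Suc k) * arccos x))))
        + 0 * cheb_moment lam 0 0"
    unfolding cheb_moment_def
  proof (rule weight_integral_lincomb)
    fix x :: real assume x: "x \<in> {-1..1}"
    define t where "t = arccos x"
    have "2 * (sin t * sin (real (Suc k) * t)) = cos (real k * t) - cos (real (Suc (Suc k)) * t)"
      using cos_add[of "real (Suc k) * t" t] cos_diff[of "real (Suc k) * t" t]
      by (simp add: algebra_simps)
    then have "2 * (sin (arccos x) * sin (real (Suc k) * arccos x)) = cheb k x - cheb (Suc (Suc k)) x"
      by (simp add: cheb_def t_def)
    moreover have "(- 2) * (- (2 * lam + 1) * x * cheb (Suc k) x
            + real (Suc k) * (sin (arccos x) * sin (real (Suc k) * arccos x)))
       = (2 * lam + 1) * (2 * x * cheb (Suc k) x) - real (Suc k) * (2 * (sin (arccos x) * sin (real (Suc k) * arccos x)))"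
      by (simp add: algebra_simps)
    ultimately have "(- 2) * (- (2 * lam + 1) * x * cheb (Suc k) x
            + real (Suc k) * (sin (arccos x) * sin (real (Suc k) * arccos x)))
       = (2 * lam + 1) * (cheb (Suc (Suc k)) x + cheb k x) - real (Suc k) * (cheb k x - cheb (Suc (Suc k)) x)"
      by (simp only: cheb_mult_x[OF x])
    then show "(real k + 2 + 2 * lam) * (gegenbauer 0 lam x * cheb (Suc (Suc k)) x) =
          (real k - 2 * lam) * (gegenbauer 0 lam x * cheb k x)
       + (- 2) * (- (2 * lam + 1) * x * cheb (Suc k) x
            + real (Suc k) * (sin (arccos x) * sin (real (Suc k) * arccos x)))
       + 0 * (gegenbauer 0 lam x * cheb 0 x)"
      by (simp add: algebra_simps)
  qed (use assms in \<open>auto intro!: continuous_intros continuous_on_arccos\<close>)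
  then show ?thesis using has_integral_cheb_derivative[OF assms, of "Suc k"] by (simp add: integral_unique)
qed

section \<open>Closed form of the moments\<close>

lemma Gamma_real_plus1:
  fixes x :: real
  assumes "x > 0"
  shows "Gamma (x + 1) = x * Gamma x"
  using assms Gamma_plus1[of x] nonpos_Ints_nonpos[of x] by force

text \<open>
  Closed form of the moment of \<open>C\<^sub>n\<close> against \<open>T\<close> of degree \<open>n + 2 j\<close>. At \<open>n = j = 0\<close> it is junk: truncated
  subtraction makes it \<open>0\<close>, where the cancelled form \<open>0 / 0\<close> should read \<open>2\<close>.
\<close>
definition cheb_moment_value :: "real \<Rightarrow> nat \<Rightarrow> nat \<Rightarrow> real" where
  "cheb_moment_value lam n j = 2 powr (- 2 * lam) * pi / Gamma lam * real (n + 2 * j)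
      * fact (n + j - 1) / (fact n * fact j) * Gamma (real n + 2 * lam) * pochhammer (- lam) j
      / Gamma (real n + lam + 1 + real j)"

text \<open>The closed form satisfies \<open>cheb_moment_recurrence\<close> along the diagonals k =
  n + 2 j, where lowering n by one pairs with raising or keeping j.\<close>

lemma cheb_moment_value_Suc_Suc:
  assumes "lam > 0"
  shows "real (n + 2) * cheb_moment_value lam (Suc (Suc n)) j =
     (real n + 1 + lam) * cheb_moment_value lam (Suc n) (Suc j)
      + (real n + 1 + lam) * cheb_moment_value lam (Suc n) j
      + (- (real n + 2 * lam)) * cheb_moment_value lam n (Suc j)"
proof -
  define G where "G = Gamma (real n + j + lam + 2)"
  define H where "H = Gamma (real n + 2 * lam)"
  define P where "P = pochhammer (- lam) j"
  define \<kappa> where "\<kappa> = 2 powr (- 2 * lam) * pi / Gamma lam"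
  define F where "F = (fact (n + j) :: real)"
  define N where "N = (fact n :: real)"
  define J where "J = (fact j :: real)"
  have nz: "G > 0" "N > 0" "J > 0" using assms by (auto simp: G_def N_def J_def)
  have G: "Gamma (real n + j + lam + 3) = (real n + j + lam + 2) * G"
    using Gamma_real_plus1[of "real n + j + lam + 2"] assms by (simp add: G_def add_ac)
  have H1: "Gamma (real n + 2 * lam + 1) = (real n + 2 * lam) * H"
    using Gamma_real_plus1[of "real n + 2 * lam"] assms by (simp add: H_def add_ac)
  have H2: "Gamma (real n + 2 * lam + 2) = (real n + 2 * lam + 1) * (real n + 2 * lam) * H"
    using Gamma_real_plus1[of "real n + 2 * lam + 1"] assms H1 by (simp add: add_ac)
  have f: "fact (Suc (n + j)) = (real n + j + 1) * F" "fact (Suc n) = (real n + 1) * N"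
     "fact (Suc (Suc n)) = (real n + 2) * (real n + 1) * N" "fact (Suc j) = (real j + 1) * J"
    by (auto simp: F_def N_def J_def algebra_simps)
  have 1: "cheb_moment_value lam (Suc (Suc n)) j = \<kappa> * (real n + 2 + 2 * j) * ((real n + j + 1) * F)
       / ((real n + 2) * (real n + 1) * N * J) * ((real n + 2 * lam + 1) * (real n + 2 * lam) * H) * P
       / ((real n + j + lam + 2) * G)"
    unfolding cheb_moment_value_def \<kappa>_def[symmetric] P_def[symmetric] J_def[symmetric] G[symmetric] H2[symmetric] f[symmetric]
    by (simp add: add_ac del: fact_Suc)
  have 2: "cheb_moment_value lam (Suc n) (Suc j) = \<kappa> * (real n + 3 + 2 * j) * ((real n + j + 1) * F)
       / ((real n + 1) * N * ((real j + 1) * J)) * ((real n + 2 * lam) * H) * (P * (- lam + j))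
       / ((real n + j + lam + 2) * G)"
    unfolding cheb_moment_value_def \<kappa>_def[symmetric] P_def pochhammer_Suc[symmetric] G[symmetric] H1[symmetric] f[symmetric]
    by (simp add: add_ac del: fact_Suc)
  have 3: "cheb_moment_value lam (Suc n) j = \<kappa> * (real n + 1 + 2 * j) * F
       / ((real n + 1) * N * J) * ((real n + 2 * lam) * H) * P / G"
    unfolding cheb_moment_value_def \<kappa>_def[symmetric] P_def[symmetric] J_def[symmetric] G_def H1[symmetric] f[symmetric] F_def
    by (simp add: add_ac del: fact_Suc)
  have 4: "cheb_moment_value lam n (Suc j) = \<kappa> * (real n + 2 + 2 * j) * F
       / (N * ((real j + 1) * J)) * H * (P * (- lam + j)) / G"
    unfolding cheb_moment_value_def \<kappa>_def[symmetric] P_def pochhammer_Suc[symmetric] G_def H_def N_def f[symmetric] F_def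
    by (simp add: add_ac del: fact_Suc)
  \<comment> \<open>The factor common to all four terms. Once it is extracted, what remains is a
    polynomial identity in n, j and lam.\<close>
  define C where "C = \<kappa> * F * H * P * (real n + 2 * lam) / ((real n + 1) * N * ((real j + 1) * J) * ((real n + j + lam + 2) * G))"
  have pos: "real n + 1 \<noteq> 0" "real n + 2 \<noteq> 0" "real j + 1 \<noteq> 0" "real n + j + lam + 2 \<noteq> 0" "G \<noteq> 0" "N \<noteq> 0" "J \<noteq> 0"
    using assms nz by auto
  have frac: "q * (\<kappa> * A * (B * F) / (q * p * N * J) * (D * L * H) * P / (E * G))
       = \<kappa> * F * H * P * L / (p * N * (r * J) * (E * G)) * (A * B * r * D)"
    "X * (\<kappa> * A * (B * F) / (p * N * (r * J)) * (L * H) * (P * Y) / (E * G))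
       = \<kappa> * F * H * P * L / (p * N * (r * J) * (E * G)) * (X * A * B * Y)"
    "X * (\<kappa> * A * F / (p * N * J) * (L * H) * P / G)
       = \<kappa> * F * H * P * L / (p * N * (r * J) * (E * G)) * (X * A * r * E)"
    "L * (\<kappa> * A * F / (N * (r * J)) * H * (P * Y) / G)
       = \<kappa> * F * H * P * L / (p * N * (r * J) * (E * G)) * (A * p * Y * E)"
    if "p \<noteq> 0" "q \<noteq> 0" "r \<noteq> 0" "E \<noteq> 0" for A B D E L X Y p q r
    using that nz by (simp_all add: mult_ac)
  have comb: "a = b + c + - d" if "a = C * x1" "b = C * x2" "c = C * x3" "d = C * x4" "x1 = x2 + x3 - x4"
    for a b c d x1 x2 x3 x4
    using that by (simp add: algebra_simps)
  have q: "real (n + 2) = real n + 2" by simp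
  show ?thesis
    unfolding mult_minus_left q
  proof (rule comb)
    show "(real n + 2) * cheb_moment_value lam (Suc (Suc n)) j
        = C * ((real n + 2 + 2 * j) * (real n + j + 1) * (real j + 1) * (real n + 2 * lam + 1))"
      unfolding 1 C_def by (rule frac(1)) (use pos in auto)
    show "(real n + 1 + lam) * cheb_moment_value lam (Suc n) (Suc j)
        = C * ((real n + 1 + lam) * (real n + 3 + 2 * j) * (real n + j + 1) * (- lam + j))"
      unfolding 2 C_def by (rule frac(2)) (use pos in auto)
    show "(real n + 1 + lam) * cheb_moment_value lam (Suc n) j
        = C * ((real n + 1 + lam) * (real n + 1 + 2 * j) * (real j + 1) * (real n + j + lam + 2))"
      unfolding 3 C_def by (rule frac(3)) (use pos in auto)
    show "(real n + 2 * lam) * cheb_moment_value lam n (Suc j)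
        = C * ((real n + 2 + 2 * j) * (real n + 1) * (- lam + j) * (real n + j + lam + 2))"
      unfolding 4 C_def by (rule frac(4)) (use pos in auto)
    show "(real n + 2 + 2 * j) * (real n + j + 1) * (real j + 1) * (real n + 2 * lam + 1)
       = (real n + 1 + lam) * (real n + 3 + 2 * j) * (real n + j + 1) * (- lam + j)
        + (real n + 1 + lam) * (real n + 1 + 2 * j) * (real j + 1) * (real n + j + lam + 2)
        - (real n + 2 + 2 * j) * (real n + 1) * (- lam + j) * (real n + j + lam + 2)"
      by (simp add: algebra_simps)
  qed
qed

lemma cheb_moment_0_0:
  assumes "lam > 0"
  shows "cheb_moment lam 0 0 = gegenbauer_norm 0 lam"
  using has_integral_gegenbauer_weight[OF assms] by (simp add: cheb_moment_def integral_unique)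

lemma cheb_moment_0_odd:
  assumes "lam > 0" "odd k"
  shows "cheb_moment lam 0 k = 0"
  using assms(2)
proof (induction k rule: less_induct)
  case (less k)
  show ?case
  proof (cases "k = 1")
    case True
    then show ?thesis using cheb_moment_0_1[OF assms(1)] by simp
  next
    case False
    then obtain l where l: "k = Suc (Suc l)" using less.prems by (metis One_nat_def even_zero not0_implies_Suc)
    then have "(real l + 2 + 2 * lam) * cheb_moment lam 0 k = 0"
      using cheb_moment_0_recurrence[OF assms(1), of l] less.IH[of l] less.prems by simp
    then show ?thesis using assms(1) by (simp add: add_eq_0_iff)
  qed
qed

text \<open>Each step of the recurrence multiplies by (j - lam)/(lam + 1 + j), which extends the
  Pochhammer symbol above and the Gamma factor below. It also covers j = 0, where
  \<open>cheb_moment_value\<close> is junk.\<close>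

lemma cheb_moment_0_even:
  assumes "lam > 0"
  shows "cheb_moment lam 0 (2 * j) = 2 * (2 powr (- 2 * lam) * pi / Gamma lam) * Gamma (2 * lam)
           * pochhammer (- lam) j / Gamma (lam + 1 + real j)"
proof (induction j)
  case 0
  have "Gamma lam > 0" using assms by simp
  moreover have "(2::real) powr (1 - 2 * lam) = 2 * 2 powr (- 2 * lam)"
    by (simp add: powr_diff powr_minus field_simps)
  ultimately show ?case using assms
    by (simp add: cheb_moment_0_0 gegenbauer_norm_def Gamma_real_plus1 power2_eq_square mult_ac)
next
  case (Suc j)
  define G where "G = Gamma (lam + 1 + real j)"
  have G: "Gamma (lam + 1 + real (Suc j)) = (lam + 1 + real j) * G"
    using Gamma_real_plus1[of "lam + 1 + real j"] assms by (simp add: G_def add_ac)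
  have "(real (2 * j) + 2 + 2 * lam) * cheb_moment lam 0 (2 * Suc j)
      = (real (2 * j) - 2 * lam) * cheb_moment lam 0 (2 * j)"
    using cheb_moment_0_recurrence[OF assms, of "2 * j"] by simp
  then have "cheb_moment lam 0 (2 * Suc j) = (real j - lam) / (lam + 1 + real j) * cheb_moment lam 0 (2 * j)"
    using assms by (simp add: field_simps)
  also have "\<dots> = 2 * (2 powr (- 2 * lam) * pi / Gamma lam) * Gamma (2 * lam)
           * (pochhammer (- lam) j * (- lam + real j)) / ((lam + 1 + real j) * G)"
    unfolding Suc G_def[symmetric] by (simp add: mult_ac)
  finally show ?case unfolding G pochhammer_Suc .
qed

lemma cheb_moment_value_0:
  assumes "lam > 0"
  shows "cheb_moment lam 0 (2 * Suc j) = cheb_moment_value lam 0 (Suc j)"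
proof -
  have "real (0 + 2 * Suc j) * fact (0 + Suc j - 1) = 2 * (fact 0 * fact (Suc j))"
    by (simp add: algebra_simps)
  then have "real (0 + 2 * Suc j) * fact (0 + Suc j - 1) / (fact 0 * fact (Suc j)) = 2"
    by (simp only:) simp
  then have "K * real (0 + 2 * Suc j) * fact (0 + Suc j - 1) / (fact 0 * fact (Suc j)) = 2 * K" for K :: real
    by (metis (no_types, lifting) mult.assoc mult.commute times_divide_eq_right)
  then show ?thesis
    unfolding cheb_moment_0_even[OF assms] cheb_moment_value_def by (simp only: of_nat_0 add_0)
qed

lemma cheb_moment_value_1:
  assumes "lam > 0"
  shows "cheb_moment lam (Suc 0) (Suc (2 * j)) = cheb_moment_value lam (Suc 0) j"
proof -
  define G where "G = Gamma (lam + 1 + real j)"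
  have "G > 0" using assms by (simp add: G_def)
  have G: "Gamma (lam + 1 + real (Suc j)) = (lam + 1 + real j) * G"
    using Gamma_real_plus1[of "lam + 1 + real j"] assms by (simp add: G_def add_ac)
  define K where "K = 2 powr (- 2 * lam) * pi / Gamma lam * Gamma (2 * lam) * pochhammer (- lam) j"
  have "cheb_moment lam (Suc 0) (Suc (2 * j)) = lam * cheb_moment lam 0 (2 * Suc j) + lam * cheb_moment lam 0 (2 * j)"
    using cheb_moment_1[OF assms, of "2 * j"] by simp
  also have "\<dots> = lam * (2 * K * (real j - lam) / ((lam + 1 + real j) * G)) + lam * (2 * K / G)"
    unfolding cheb_moment_0_even[OF assms] G pochhammer_Suc G_def[symmetric] by (simp add: K_def algebra_simps)
  also have "2 * K / G = 2 * K * (lam + 1 + real j) / ((lam + 1 + real j) * G)"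
    using assms \<open>G > 0\<close> by (simp add: divide_simps)
  also have "lam * (2 * K * (real j - lam) / ((lam + 1 + real j) * G)) + lam * \<dots>
      = 2 * lam * K * (1 + 2 * real j) / ((lam + 1 + real j) * G)"
    by (simp add: add_divide_distrib[symmetric] algebra_simps)
  also have "\<dots> = cheb_moment_value lam (Suc 0) j"
    using assms Gamma_real_plus1[of "2 * lam"] G
    by (simp add: cheb_moment_value_def K_def add_ac)
  finally show ?thesis .
qed

text \<open>The second part combines orthogonality to lower degrees with parity. Both parts go
  through one induction, because the recurrence for row n mixes vanishing and nonvanishing moments
  of the two rows before it.\<close>

lemma cheb_moment_eq:
  assumes "lam > 0"
  shows "(\<forall>j. n + 2 * j > 0 \<longrightarrow> cheb_moment lam n (n + 2 * j) = cheb_moment_value lam n j) \<and>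
         (\<forall>k. k < n \<or> odd (n + k) \<longrightarrow> cheb_moment lam n k = 0)"
proof (induction n rule: less_induct)
  case (less n)
  consider "n = 0" | "n = 1" | m where "n = Suc (Suc m)"
    by (metis One_nat_def not0_implies_Suc)
  then show ?case
  proof cases
    case 1
    show ?thesis
    proof (intro conjI allI impI)
      fix j assume "n + 2 * j > 0"
      then obtain i where "j = Suc i" using 1 by (cases j) auto
      then show "cheb_moment lam n (n + 2 * j) = cheb_moment_value lam n j"
        using 1 cheb_moment_value_0[OF assms, of i] by simp
    qed (use 1 cheb_moment_0_odd[OF assms] in auto)
  next
    case 2
    show ?thesis
    proof (intro conjI allI impI)
      fix k assume k: "k < n \<or> odd (n + k)"
      show "cheb_moment lam n k = 0"
      proof (cases k)
        case 0
        then show ?thesis using 2 cheb_moment_1_0[OF assms] cheb_moment_0_1[OF assms] by simp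
      next
        case (Suc l)
        then show ?thesis using k 2 cheb_moment_1[OF assms, of l] cheb_moment_0_odd[OF assms] by simp
      qed
    qed (use 2 cheb_moment_value_1[OF assms] in simp)
  next
    case 3
    have I1: "\<And>j. cheb_moment lam (Suc m) (Suc m + 2 * j) = cheb_moment_value lam (Suc m) j"
      "\<And>k. k < Suc m \<or> odd (Suc m + k) \<Longrightarrow> cheb_moment lam (Suc m) k = 0"
      using less.IH[of "Suc m"] 3 by auto
    have I0: "\<And>j. m + 2 * j > 0 \<Longrightarrow> cheb_moment lam m (m + 2 * j) = cheb_moment_value lam m j"
      "\<And>k. k < m \<or> odd (m + k) \<Longrightarrow> cheb_moment lam m k = 0"
      using less.IH[of m] 3 by auto
    show ?thesis
    proof (intro conjI allI impI)
      fix j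
      have "real (m + 2) * cheb_moment lam n (n + 2 * j) = real (m + 2) * cheb_moment_value lam n j"
        using cheb_moment_recurrence[OF assms, of m "Suc m + 2 * j"] cheb_moment_value_Suc_Suc[OF assms, of m j]
          I1(1)[of "Suc j"] I1(1)[of j] I0(1)[of "Suc j"] 3 by simp
      then show "cheb_moment lam n (n + 2 * j) = cheb_moment_value lam n j"
        by (subst (asm) mult_left_cancel) auto
    next
      fix k assume k: "k < n \<or> odd (n + k)"
      have "real (m + 2) * cheb_moment lam n k = 0"
      proof (cases k)
        case 0
        show ?thesis
        proof (cases m)
          \<comment> \<open>Here n = 2 and k = 0. The moment at (0, 0) is exactly the junk case of
            the closed form, so \<open>cheb_moment_0_even\<close> supplies it.\<close>
          case 0
          have "cheb_moment lam (Suc 0) (Suc 0) = lam * (2 * (2 powr (- 2 * lam) * pi / Gamma lam) * Gamma (2 * lam) / Gamma (lam + 2))"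
            using I1(1)[of 0] 0 Gamma_real_plus1[of "2 * lam"] assms
            by (simp add: cheb_moment_value_def add_ac)
          moreover have "cheb_moment lam 0 0 = 2 * (2 powr (- 2 * lam) * pi / Gamma lam) * Gamma (2 * lam) / Gamma (lam + 1)"
            using cheb_moment_0_even[OF assms, of 0] by simp
          moreover have "Gamma (lam + 2) = (lam + 1) * Gamma (lam + 1)"
            using Gamma_real_plus1[of "lam + 1"] assms by (simp add: add_ac)
          ultimately have "(1 + lam) * cheb_moment lam (Suc 0) (Suc 0) = lam * cheb_moment lam 0 0"
            using assms by (simp add: add_ac)
          then show ?thesis using cheb_moment_recurrence_0[OF assms, of 0] 0 \<open>k = 0\<close> 3
            by (simp add: algebra_simps)
        next
          case (Suc l)
          then show ?thesis using cheb_moment_recurrence_0[OF assms, of m] \<open>k = 0\<close> 3 k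
            I1(2)[of "Suc 0"] I0(2)[of 0] by simp
        qed
      next
        case (Suc l)
        note rec = cheb_moment_recurrence[OF assms, of m l]
        show ?thesis
        proof (cases "k = m")
          \<comment> \<open>For k = n - 2 the recurrence retains the leading moments of rows m + 1
            and m. Their contributions cancel by the functional equation of Gamma.\<close>
          case True
          have "Gamma (real m + lam + 2) = (real m + lam + 1) * Gamma (real m + lam + 1)"
            using Gamma_real_plus1[of "real m + lam + 1"] assms by (simp add: add_ac)
          moreover have "Gamma (real m + 2 * lam + 1) = (real m + 2 * lam) * Gamma (real m + 2 * lam)"
            using Gamma_real_plus1[of "real m + 2 * lam"] assms by (simp add: add_ac)
          moreover have "(fact m :: real) = real m * fact (m - 1)"
            using True Suc by (cases m) auto
          ultimately have "(real m + 1 + lam) * cheb_moment_value lam (Suc m) 0 = (real m + 2 * lam) * cheb_moment_value lam m 0"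
            using assms True Suc by (simp add: cheb_moment_value_def add_ac)
          then show ?thesis using rec True Suc I1(1)[of 0] I1(2)[of l] I0(1)[of 0] 3 by (simp add: algebra_simps)
        next
          case False
          show ?thesis
          proof (cases "odd (n + k)")
            case True
            then show ?thesis using rec Suc I1(2)[of "Suc k"] I1(2)[of l] I0(2)[of k] 3 by simp
          next
            case ev: False
            \<comment> \<open>The value k = m + 1 is ruled out by parity, so all three moments on
              the right vanish.\<close>
            then have "k < m" using False k 3 by (auto simp: less_Suc_eq)
            then show ?thesis using rec Suc I1(2)[of "Suc k"] I1(2)[of l] I0(2)[of k] 3 by simp
          qed
        qed
      qed
      then show "cheb_moment lam n k = 0" by simp
    qed
  qed
qed

section \<open>Integrating dominated series, and the Euler integral\<close>

text \<open>Dominated convergence for the partial sums. The factor \<open>W\<close> stands apart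
  from the series because it may be unbounded, as the Beta and Gegenbauer weights can be; only its
  norm has to be integrable.\<close>

lemma sums_integral_dominated:
  fixes W :: "real \<Rightarrow> complex" and \<phi> :: "nat \<Rightarrow> real \<Rightarrow> complex"
  assumes W: "(\<lambda>x. norm (W x)) integrable_on S"
    and int: "\<And>k. (\<lambda>x. W x * \<phi> k x) integrable_on S"
    and bd: "\<And>k x. x \<in> S \<Longrightarrow> norm (\<phi> k x) \<le> B k" and B: "summable B"
    and sums: "\<And>x. x \<in> S \<Longrightarrow> (\<lambda>k. \<phi> k x) sums \<Phi> x"
  shows "(\<lambda>k. integral S (\<lambda>x. W x * \<phi> k x)) sums integral S (\<lambda>x. W x * \<Phi> x)"
    and "(\<lambda>x. W x * \<Phi> x) integrable_on S"
proof -
  define F where "F N x = (\<Sum>k<N. W x * \<phi> k x)" for N x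
  define h where "h x = suminf B * norm (W x)" for x
  have F: "F N integrable_on S" for N
    unfolding F_def[abs_def] by (intro integrable_sum int) auto
  have h: "h integrable_on S"
    unfolding h_def by (rule integrable_on_mult_right[OF W])
  have le: "norm (F N x) \<le> h x" if "x \<in> S" for N x
  proof -
    have "norm (\<phi> k x) \<ge> 0" for k by simp
    then have B0: "B k \<ge> 0" for k using bd[OF that, of k] by (meson order_trans)
    have "norm (F N x) = norm (W x) * norm (\<Sum>k<N. \<phi> k x)"
      by (simp add: F_def norm_mult flip: sum_distrib_left)
    also have "norm (\<Sum>k<N. \<phi> k x) \<le> (\<Sum>k<N. B k)"
      using bd[OF that] by (intro sum_norm_le) auto
    also have "\<dots> \<le> suminf B" using B B0 by (intro sum_le_suminf) auto
    finally show ?thesis by (simp add: h_def mult.commute[of "suminf B"] mult_left_mono)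
  qed
  have lim: "(\<lambda>N. F N x) \<longlonglongrightarrow> W x * \<Phi> x" if "x \<in> S" for x
    using sums_mult[OF sums[OF that], of "W x"] by (simp add: sums_def F_def)
  show "(\<lambda>x. W x * \<Phi> x) integrable_on S"
    by (rule dominated_convergence(1)[OF F h le lim])
  have "(\<lambda>N. integral S (F N)) \<longlonglongrightarrow> integral S (\<lambda>x. W x * \<Phi> x)"
    by (rule dominated_convergence(2)[OF F h le lim])
  moreover have "integral S (F N) = (\<Sum>k<N. integral S (\<lambda>x. W x * \<phi> k x))" for N
    unfolding F_def[abs_def] by (intro integral_sum int) auto
  ultimately show "(\<lambda>k. integral S (\<lambda>x. W x * \<phi> k x)) sums integral S (\<lambda>x. W x * \<Phi> x)"
    by (simp add: sums_def)
qed

section \<open>Euler's integral for the hypergeometric series\<close>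

lemma has_integral_beta_nat:
  fixes lam :: real
  assumes "lam > 0"
  shows "((\<lambda>t. t ^ m * (1 - t) powr (lam - 1)) has_integral Beta (real m + 1) lam) {0..1}"
proof -
  have "((\<lambda>t. t powr real m * (1 - t) powr (lam - 1)) has_integral Beta (real m + 1) lam) {0..1}"
    using has_integral_Beta_real[of "real m + 1" lam] assms by simp
  then show ?thesis
    \<comment> \<open>At t = 0 and m = 0 the power \<open>t ^ m\<close> is 1 while
      \<open>t powr real m\<close> is 0, so this point is excluded.\<close>
    by (rule has_integral_spike[of "{0}", rotated 2]) (auto simp: powr_realpow)
qed

lemma Beta_shift_ratio:
  fixes lam :: real
  assumes "lam > 0"
  shows "Beta (real (n + j) + 1) lam = Beta (real n + 1) lam * (pochhammer (real n + 1) j / pochhammer (real n + lam + 1) j)"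
proof (induction j)
  case (Suc j)
  have "(real (n + j) + 1 + lam) * Beta (real (n + j) + 1 + 1) lam = (real (n + j) + 1) * Beta (real (n + j) + 1) lam"
    by (rule Beta_plus1_left) (use assms nonpos_Ints_nonpos[of "real (n + j) + 1"] in force)
  moreover have "real (n + j) + 1 + lam > 0" using assms by simp
  ultimately have "Beta (real (n + j) + 1 + 1) lam
      = Beta (real (n + j) + 1) lam * ((real (n + j) + 1) / (real (n + j) + 1 + lam))"
    by (simp add: field_simps)
  then show ?case
    unfolding Suc by (simp add: pochhammer_Suc add_ac)
qed auto

lemma gchoose_minus_pochhammer:
  fixes a :: "'a::field_char_0"
  shows "(a gchoose j) * (- z) ^ j = pochhammer (- a) j / fact j * z ^ j"
proof -
  have "(-1::'a) ^ j * (-1) ^ j = 1" by (simp flip: power_mult_distrib)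
  then have "(-1) ^ j * ((-1) ^ j * x) = x" for x :: 'a by (metis mult.assoc mult_1)
  then show ?thesis by (simp add: gbinomial_pochhammer power_minus[of z] mult_ac)
qed

text \<open>The Taylor coefficients of the Gauss hypergeometric function F(n + 1, 1 - lam; n + lam +
  1; v).\<close>

definition hyper_coeff :: "real \<Rightarrow> nat \<Rightarrow> nat \<Rightarrow> real" where
  "hyper_coeff lam n j = pochhammer (real n + 1) j * pochhammer (1 - lam) j
     / (pochhammer (real n + lam + 1) j * fact j)"

text \<open>For 0 <= r < 1, the maximum of |1 - v|^(lam - 1) over |v| <= r: it is attained at v = r
  when lam <= 1 and at v = -r otherwise.\<close>

definition euler_factor :: "real \<Rightarrow> real \<Rightarrow> real" where
  "euler_factor lam r = (if lam \<le> 1 then (1 - r) powr (lam - 1) else (1 + r) powr (lam - 1))"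

lemma norm_powr_le_euler_factor:
  fixes v :: complex
  assumes "0 < lam" "norm v \<le> r" "r < 1"
  shows "norm ((1 - v) powr of_real (lam - 1)) \<le> euler_factor lam r"
proof -
  have lo: "1 - r \<le> norm (1 - v)" using norm_triangle_ineq2[of 1 v] assms by simp
  have hi: "norm (1 - v) \<le> 1 + r" using norm_triangle_ineq4[of 1 v] assms by simp
  have "norm ((1 - v) powr of_real (lam - 1)) = norm (1 - v) powr (lam - 1)"
    by (subst norm_powr_real_powr') auto
  also have "\<dots> \<le> euler_factor lam r"
  proof (cases "lam \<le> 1")
    case True
    then show ?thesis using lo assms by (simp add: euler_factor_def powr_mono2')
  next
    case False
    then show ?thesis using hi by (simp add: euler_factor_def powr_mono2)
  qed
  finally show ?thesis .
qed

text \<open>The binomial series of (1 - t v)^(lam - 1) is integrated termwise against t^n (1 -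
  t)^(lam - 1). Division by the total mass \<open>b\<close> makes the sum a weighted mean, so the
  pointwise bound by \<open>euler_factor\<close> passes to it.\<close>

lemma hyper_series:
  fixes v :: complex
  assumes lam: "lam > 0" and v: "norm v < 1"
  shows "\<exists>S. (\<lambda>j. of_real (hyper_coeff lam n j) * v ^ j) sums S \<and> norm S \<le> euler_factor lam (norm v)"
proof -
  define w where "w t = t ^ n * (1 - t) powr (lam - 1)" for t :: real
  define b where "b = Beta (real n + 1) lam"
  define r where "r = norm v"
  have r: "0 \<le> r" "r < 1" using v by (auto simp: r_def)
  have b: "b > 0" using lam by (simp add: b_def Beta_def)
  define \<phi> where "\<phi> j t = (complex_of_real (lam - 1) gchoose j) * (- (of_real t * v)) ^ j" for j and t :: real
  define \<Phi> where "\<Phi> t = (1 - of_real t * v) powr of_real (lam - 1)" for t :: real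
  define W where "W t = complex_of_real (w t)" for t
  have w: "(w has_integral b) {0..1}"
    using has_integral_beta_nat[OF lam, of n] by (simp add: w_def[abs_def] b_def)
  have w0: "w t \<ge> 0" if "t \<in> {0..1}" for t using that by (simp add: w_def)
  have tv: "norm (of_real t * v) \<le> r" if "t \<in> {0..1}" for t
    using that mult_right_mono[of t 1 "norm v"] by (simp add: norm_mult r_def)
  have conv: "ereal r < conv_radius (\<lambda>j. complex_of_real (lam - 1) gchoose j)"
    using r conv_radius_gchoose[of "complex_of_real (lam - 1)"] by auto
  \<comment> \<open>The binomial series has radius of convergence at least 1 and r < 1, which gives
    a majorant uniform in t.\<close>
  have B: "summable (\<lambda>j. norm ((complex_of_real (lam - 1) gchoose j) * of_real r ^ j))"
    using conv r by (intro abs_summable_in_conv_radius) auto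
  have W: "(\<lambda>t. norm (W t)) integrable_on {0..1}"
    using w w0 by (subst integrable_cong[of _ _ w]) (auto simp: W_def)
  have Wphi: "((\<lambda>t. W t * \<phi> j t) has_integral of_real (b * hyper_coeff lam n j) * v ^ j) {0..1}" for j
  proof -
    have "((\<lambda>t. of_real (t ^ (n + j) * (1 - t) powr (lam - 1)) * (complex_of_real (pochhammer (1 - lam) j / fact j) * v ^ j))
       has_integral of_real (Beta (real (n + j) + 1) lam) * (complex_of_real (pochhammer (1 - lam) j / fact j) * v ^ j)) {0..1}"
      using has_integral_beta_nat[OF lam, of "n + j"]
      by (intro has_integral_mult_left has_integral_of_real)
    moreover have "W t * \<phi> j t = of_real (t ^ (n + j) * (1 - t) powr (lam - 1)) * (complex_of_real (pochhammer (1 - lam) j / fact j) * v ^ j)" for t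
    proof -
      have "- complex_of_real (lam - 1) = of_real (1 - lam)" by simp
      then have "pochhammer (- complex_of_real (lam - 1)) j = of_real (pochhammer (1 - lam) j)"
        by (simp only: pochhammer_of_real)
      then show ?thesis
        unfolding \<phi>_def gchoose_minus_pochhammer
        by (simp add: W_def w_def power_add power_mult_distrib)
    qed
    moreover have "of_real (Beta (real (n + j) + 1) lam) * (complex_of_real (pochhammer (1 - lam) j / fact j) * v ^ j)
      = of_real (b * hyper_coeff lam n j) * v ^ j"
      unfolding Beta_shift_ratio[OF lam] b_def hyper_coeff_def by simp
    ultimately show ?thesis by simp
  qed
  have sums\<phi>: "(\<lambda>j. \<phi> j t) sums \<Phi> t" if "t \<in> {0..1}" for t
    using gen_binomial_complex[of "- (of_real t * v)" "of_real (lam - 1)"] tv[OF that] r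
    by (simp add: \<phi>_def \<Phi>_def)
  have bd: "norm (\<phi> j t) \<le> norm ((complex_of_real (lam - 1) gchoose j) * of_real r ^ j)" if "t \<in> {0..1}" for j t
    using tv[OF that] r by (auto simp: \<phi>_def norm_mult norm_power intro!: mult_left_mono power_mono)
  have int: "(\<lambda>t. W t * \<phi> j t) integrable_on {0..1}" for j
    using Wphi[of j] by (rule has_integral_integrable)
  define I where "I = integral {0..1} (\<lambda>t. W t * \<Phi> t)"
  have "(\<lambda>j. integral {0..1} (\<lambda>t. W t * \<phi> j t)) sums I"
    unfolding I_def by (rule sums_integral_dominated(1)[OF W int bd B sums\<phi>])
  then have "(\<lambda>j. of_real b * (of_real (hyper_coeff lam n j) * v ^ j)) sums I"
    using integral_unique[OF Wphi] by (simp add: mult_ac)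
  from sums_divide[OF this, of "of_real b"]
  have sumsI: "(\<lambda>j. of_real (hyper_coeff lam n j) * v ^ j) sums (I / of_real b)" using b by simp
  have nI: "norm I \<le> integral {0..1} (\<lambda>t. w t * euler_factor lam r)"
    unfolding I_def
  proof (rule integral_norm_bound_integral)
    show "(\<lambda>t. W t * \<Phi> t) integrable_on {0..1}"
      by (rule sums_integral_dominated(2)[OF W int bd B sums\<phi>])
    show "(\<lambda>t. w t * euler_factor lam r) integrable_on {0..1}"
      using w by (intro integrable_on_mult_left) auto
    fix t :: real assume t: "t \<in> {0..1}"
    show "norm (W t * \<Phi> t) \<le> w t * euler_factor lam r"
      using norm_powr_le_euler_factor[OF lam tv[OF t] r(2)] w0[OF t]
      by (auto simp: W_def \<Phi>_def norm_mult intro!: mult_left_mono)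
  qed
  have "norm I \<le> b * euler_factor lam r"
    using nI unfolding integral_unique[OF has_integral_mult_left[OF w, of "euler_factor lam r"]] .
  then have "norm (I / of_real b) \<le> euler_factor lam r"
    using b by (simp add: norm_divide field_simps)
  then show ?thesis using sumsI unfolding r_def by blast
qed

section \<open>The generating function of the moments\<close>

text \<open>For n >= 1 this is twice the coefficient of C_n in the Gegenbauer expansion of T_n. It
  is the Gamma ratio that the Stirling bound later estimates.\<close>

definition gegenbauer_const :: "real \<Rightarrow> nat \<Rightarrow> real" where
  "gegenbauer_const lam n = Gamma lam * Gamma (real n + 1) / Gamma (real n + lam)"

lemma gegenbauer_norm_times_const:
  assumes "lam > 0"
  shows "gegenbauer_norm n lam * gegenbauer_const lam n
     = 2 * (2 powr (- 2 * lam) * pi / Gamma lam) * Gamma (real n + 2 * lam) / Gamma (real n + lam + 1)"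
proof -
  define g where "g = Gamma lam"
  define m where "m = Gamma (real n + 1)"
  define d where "d = Gamma (real n + lam)"
  define e where "e = real n + lam"
  have nz: "g > 0" "m > 0" "d > 0" "e > 0" using assms by (auto simp: g_def m_def d_def e_def)
  have 1: "Gamma (real n + lam + 1) = e * d"
    using assms by (simp add: Gamma_real_plus1 d_def e_def)
  have 2: "(2::real) powr (1 - 2 * lam) = 2 * 2 powr (- 2 * lam)"
    by (simp add: powr_diff powr_minus field_simps)
  show ?thesis
    unfolding gegenbauer_norm_def gegenbauer_const_def 1 2 g_def[symmetric] m_def[symmetric]
      d_def[symmetric]
    unfolding e_def[symmetric]
    using nz by (simp add: power2_eq_square mult_ac)
qed

text \<open>Differences of consecutive coefficients are the Taylor coefficients of (1 - v) F(v).
  Over a common denominator the difference has numerator -lam (n + 2 j), which accounts for the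
  linear factor and the shifted Pochhammer symbol in the closed form.\<close>

lemma cheb_moment_value_hyper:
  assumes lam: "lam > 0" and n: "n \<ge> 1"
  shows "2 * cheb_moment_value lam n j = gegenbauer_norm n lam * gegenbauer_const lam n
           * (hyper_coeff lam n j - (if j = 0 then 0 else hyper_coeff lam n (j - 1)))"
proof (cases j)
  case 0
  have "real n * fact (n - 1) = fact n" using n by (cases n) simp_all
  then have *: "c * real n * fact (n - 1) / fact n = c" for c :: real
    by (simp add: mult.assoc)
  show ?thesis
    unfolding gegenbauer_norm_times_const[OF lam] using 0 *[of "2 powr - (2 * lam) * pi / Gamma lam"]
    by (simp add: cheb_moment_value_def hyper_coeff_def)
next
  case (Suc i)
  define \<kappa> where "\<kappa> = 2 powr (- 2 * lam) * pi / Gamma lam"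
  define H where "H = Gamma (real n + 2 * lam)"
  define G where "G = Gamma (real n + lam + 1)"
  define A where "A = pochhammer (real n + 1) i"
  define B where "B = pochhammer (1 - lam) i"
  define Q where "Q = pochhammer (real n + lam + 1) i"
  define I where "I = (fact i :: real)"
  define N where "N = (fact n :: real)"
  have nz: "G > 0" "Q > 0" "I > 0" "N > 0" using lam by (auto simp: G_def Q_def I_def N_def intro!: pochhammer_pos)
  have "fact (n + i) = (fact n * pochhammer (real n + 1) i :: real)" for i
    by (induction i) (auto simp: pochhammer_Suc algebra_simps)
  then have f1: "fact (n + i) = N * A" by (simp add: N_def A_def)
  have f2: "fact (Suc i) = (real i + 1) * I" by (simp add: I_def algebra_simps)
  have f3: "pochhammer (- lam) (Suc i) = - lam * B" by (simp add: B_def pochhammer_rec)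
  have f4: "Gamma (real n + lam + 1 + real (Suc i)) = Q * (real n + lam + 1 + i) * G"
  proof -
    have "real n + lam + 1 \<notin> \<int>\<^sub>\<le>\<^sub>0" using lam nonpos_Ints_nonpos[of "real n + lam + 1"] by auto
    from pochhammer_Gamma[OF this, of "Suc i"] show ?thesis
      using nz by (simp add: Q_def G_def pochhammer_Suc field_simps)
  qed
  have v: "cheb_moment_value lam n j = \<kappa> * (real n + 2 * i + 2) * (N * A) / (N * ((real i + 1) * I)) * H
      * (- lam * B) / (Q * (real n + lam + 1 + i) * G)"
    unfolding cheb_moment_value_def Suc f4 f3 f2[symmetric] f1[symmetric] \<kappa>_def H_def
    by (simp add: N_def add_ac)
  have h: "hyper_coeff lam n (Suc i) = A * (real n + 1 + i) * (B * (1 - lam + i)) / (Q * (real n + lam + 1 + i) * ((real i + 1) * I))"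
    unfolding hyper_coeff_def A_def B_def Q_def pochhammer_Suc f2 by simp
  have h': "hyper_coeff lam n i = A * B / (Q * I)"
    unfolding hyper_coeff_def A_def B_def Q_def I_def ..
  define e where "e = real n + lam + 1 + i"
  define f where "f = real i + 1"
  have ef: "e > 0" "f > 0" using lam by (auto simp: e_def f_def)
  have "hyper_coeff lam n (Suc i) - hyper_coeff lam n i
     = A * B / (Q * I * e * f) * ((real n + 1 + i) * (1 - lam + i) - e * f)"
    unfolding h h' e_def[symmetric] f_def[symmetric] using nz ef by (simp add: field_simps)
  also have "(real n + 1 + i) * (1 - lam + i) - e * f = - lam * (real n + 2 * i + 2)"
    by (simp add: e_def f_def algebra_simps)
  finally have d: "hyper_coeff lam n (Suc i) - hyper_coeff lam n i
     = A * B / (Q * I * e * f) * (- lam * (real n + 2 * i + 2))" .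
  have "2 * cheb_moment_value lam n j = 2 * \<kappa> * H / G * (A * B / (Q * I * e * f) * (- lam * (real n + 2 * i + 2)))"
    unfolding v e_def[symmetric] f_def[symmetric] using nz ef by (simp add: mult_ac)
  also have "\<dots> = gegenbauer_norm n lam * gegenbauer_const lam n * (hyper_coeff lam n (Suc i) - hyper_coeff lam n i)"
    unfolding gegenbauer_norm_times_const[OF lam] d \<kappa>_def H_def G_def ..
  finally show ?thesis by (simp add: Suc)
qed

text \<open>The usual factor in cosine series: the constant term counts once, every other term
  twice.\<close>

definition cheb_weight :: "nat \<Rightarrow> real" where
  "cheb_weight k = (if k = 0 then 1 else 2)"

text \<open>Only the degrees n + 2 j contribute, which gives q^n times a series in v = q^2, and the
  differences of hypergeometric coefficients give the factor 1 - v. Since n >= 1, every contributing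
  term has \<open>cheb_weight\<close> 2.\<close>

lemma cheb_moment_series:
  fixes q :: complex
  assumes lam: "lam > 0" and n: "n \<ge> 1" and q: "norm q < 1"
  shows "\<exists>S. (\<lambda>k. of_real (cheb_weight k * cheb_moment lam n k) * q ^ k) sums
              (of_real (gegenbauer_norm n lam * gegenbauer_const lam n) * (q ^ n * (1 - q\<^sup>2) * S))
            \<and> norm S \<le> euler_factor lam ((norm q)\<^sup>2)"
proof -
  define c where "c = gegenbauer_norm n lam * gegenbauer_const lam n"
  define v where "v = q\<^sup>2"
  have "norm v < 1" using q by (simp add: v_def norm_power abs_square_less_1)
  from hyper_series[OF lam this, of n]
  obtain S where S: "(\<lambda>j. of_real (hyper_coeff lam n j) * v ^ j) sums S"
    and nS: "norm S \<le> euler_factor lam ((norm q)\<^sup>2)"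
    by (auto simp: v_def norm_power)
  have "(\<lambda>j. (if Suc j = 0 then 0 else of_real (hyper_coeff lam n (Suc j - 1))) * v ^ Suc j) sums (v * S)"
    using sums_mult[OF S, of v] by (simp add: mult_ac)
  from sums_Suc[OF this]
  have "(\<lambda>j. (if j = 0 then 0 else of_real (hyper_coeff lam n (j - 1))) * v ^ j) sums (v * S + 0)"
    by simp
  from sums_mult[OF sums_diff[OF S this], of "of_real c * q ^ n"]
  have "(\<lambda>j. of_real c * q ^ n * (of_real (hyper_coeff lam n j) * v ^ j
        - (if j = 0 then 0 else of_real (hyper_coeff lam n (j - 1))) * v ^ j))
       sums (of_real c * q ^ n * (S - (v * S + 0)))" .
  also have "of_real c * q ^ n * (S - (v * S + 0)) = of_real c * (q ^ n * (1 - q\<^sup>2) * S)"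
    by (simp add: v_def algebra_simps)
  also have "(\<lambda>j. of_real c * q ^ n * (of_real (hyper_coeff lam n j) * v ^ j
        - (if j = 0 then 0 else of_real (hyper_coeff lam n (j - 1))) * v ^ j))
     = (\<lambda>j. of_real (cheb_weight (n + 2 * j) * cheb_moment lam n (n + 2 * j)) * q ^ (n + 2 * j))"
  proof
    fix j
    have eq: "cheb_weight (n + 2 * j) * cheb_moment lam n (n + 2 * j)
        = c * (hyper_coeff lam n j - (if j = 0 then 0 else hyper_coeff lam n (j - 1)))"
      using cheb_moment_eq[OF lam, of n] cheb_moment_value_hyper[OF lam n, of j] n
      by (simp add: c_def cheb_weight_def)
    have "of_real c * q ^ n * (of_real (hyper_coeff lam n j) * v ^ j
        - (if j = 0 then 0 else of_real (hyper_coeff lam n (j - 1))) * v ^ j)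
      = of_real (c * (hyper_coeff lam n j - (if j = 0 then 0 else hyper_coeff lam n (j - 1)))) * q ^ (n + 2 * j)"
    proof -
      have "q ^ (n + 2 * j) = q ^ n * v ^ j" by (simp add: v_def power_add power_mult)
      then show ?thesis by (cases "j = 0") (simp_all add: algebra_simps)
    qed
    then show "of_real c * q ^ n * (of_real (hyper_coeff lam n j) * v ^ j
        - (if j = 0 then 0 else of_real (hyper_coeff lam n (j - 1))) * v ^ j)
      = of_real (cheb_weight (n + 2 * j) * cheb_moment lam n (n + 2 * j)) * q ^ (n + 2 * j)"
      unfolding eq .
  qed
  finally have "(\<lambda>k. of_real (cheb_weight k * cheb_moment lam n k) * q ^ k) sums
              (of_real c * (q ^ n * (1 - q\<^sup>2) * S))"
  proof (subst (asm) sums_mono_reindex)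
    show "strict_mono (\<lambda>j. n + 2 * j)" by (auto intro!: strict_monoI)
    fix k assume k: "k \<notin> range (\<lambda>j. n + 2 * j)"
    have "k < n \<or> odd (n + k)"
    proof (rule ccontr)
      assume "\<not> (k < n \<or> odd (n + k))"
      then have "k = n + 2 * ((k - n) div 2)" by auto
      then show False using k by blast
    qed
    then have "cheb_moment lam n k = 0" using cheb_moment_eq[OF lam, of n] by blast
    then show "of_real (cheb_weight k * cheb_moment lam n k) * q ^ k = 0" by simp
  qed
  then show ?thesis using nS by (auto simp: c_def)
qed

text \<open>For x = cos t, twice T_k is the sum of the k-th powers of e^(it) and e^(-it). The series
  is therefore a sum of two geometric series, less 1 for the constant term.\<close>

lemma cheb_poisson_sums:
  fixes q :: complex
  assumes q: "norm q < 1" and x: "x \<in> {-1..1}"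
  shows "(\<lambda>k. of_real (cheb_weight k * cheb k x) * q ^ k) sums ((1 - q\<^sup>2) / (1 - 2 * q * of_real x + q\<^sup>2))"
proof -
  define t where "t = arccos x"
  define e where "e = cis t"
  define e' where "e' = cis (- t)"
  have ee: "e * e' = 1" "e + e' = 2 * of_real x"
    using x by (auto simp: e_def e'_def cis_mult complex_eq_iff t_def)
  have nq: "norm (q * e) < 1" "norm (q * e') < 1" using q by (auto simp: norm_mult e_def e'_def)
  then have nz: "1 - q * e \<noteq> 0" "1 - q * e' \<noteq> 0" by auto
  have "(\<lambda>k. (q * e) ^ k + (q * e') ^ k - (if k = 0 then 1 else 0)) sums
      (1 / (1 - q * e) + 1 / (1 - q * e') - 1)"
    using nq sums_single[of 0 "\<lambda>_. 1::complex"] by (intro sums_add sums_diff geometric_sums) auto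
  also have "(\<lambda>k. (q * e) ^ k + (q * e') ^ k - (if k = 0 then 1 else 0)) = (\<lambda>k. of_real (cheb_weight k * cheb k x) * q ^ k)"
  proof
    fix k
    have "e ^ k + e' ^ k = of_real (2 * cheb k x)"
      by (simp add: e_def e'_def Complex.DeMoivre complex_eq_iff cheb_def t_def)
    then have "(q * e) ^ k + (q * e') ^ k = of_real (2 * cheb k x) * q ^ k"
      by (metis distrib_left mult.commute power_mult_distrib)
    then show "(q * e) ^ k + (q * e') ^ k - (if k = 0 then 1 else 0) = of_real (cheb_weight k * cheb k x) * q ^ k"
      by (simp add: cheb_weight_def)
  qed
  also have "1 / (1 - q * e) + 1 / (1 - q * e') - 1 = (1 - q\<^sup>2 * (e * e')) / (1 - q * (e + e') + q\<^sup>2 * (e * e'))"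
  proof -
    have "(1 - q * e) * (1 - q * e') = 1 - q * (e + e') + q\<^sup>2 * (e * e')"
      by (simp add: algebra_simps power2_eq_square)
    then have "1 - q * (e + e') + q\<^sup>2 * (e * e') \<noteq> 0" using nz by (metis no_zero_divisors)
    then show ?thesis
      using nz \<open>(1 - q * e) * (1 - q * e') = _\<close>[symmetric] by (simp add: divide_simps) (simp add: algebra_simps power2_eq_square)
  qed
  finally show ?thesis unfolding ee by (simp add: mult_ac)
qed

lemma euler_factor_nonneg: "euler_factor lam r \<ge> 0"
  by (simp add: euler_factor_def)

section \<open>The Bernstein ellipse\<close>

text \<open>With s a square root of w, the points z - 1 and z + 1 are half the squares of s - 1/s
  and s + 1/s. The parallelogram law then gives the sum of focal distances.\<close>

lemma bernstein_region_sum: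
  assumes "rho > 0" "cmod w = rho"
  shows "cmod ((w + 1 / w) / 2 - 1) + cmod ((w + 1 / w) / 2 + 1) = rho + 1 / rho"
proof -
  define s where "s = csqrt w"
  have s: "s\<^sup>2 = w" by (simp add: s_def)
  have "w \<noteq> 0" using assms by auto
  then have nz: "s \<noteq> 0" using s by auto
  have 1: "(w + 1 / w) / 2 - 1 = (s - 1 / s)\<^sup>2 / 2" "(w + 1 / w) / 2 + 1 = (s + 1 / s)\<^sup>2 / 2"
    using nz by (simp_all add: s[symmetric] power2_eq_square field_simps)
  have "(cmod (s - 1 / s))\<^sup>2 + (cmod (s + 1 / s))\<^sup>2 = 2 * (cmod s)\<^sup>2 + 2 * (cmod (1 / s))\<^sup>2"
    unfolding cmod_power2 by (simp add: power2_eq_square algebra_simps)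
  also have "(cmod s)\<^sup>2 = rho" using s assms by (simp flip: norm_power)
  also have "(cmod (1 / s))\<^sup>2 = 1 / rho" using s assms by (simp add: norm_divide power_divide flip: norm_power)
  finally show ?thesis unfolding 1 by (simp add: norm_divide norm_power)
qed

lemma convex_bernstein_region: "convex (bernstein_region rho)"
proof (rule convexI)
  fix x y :: complex and u v :: real
  assume x: "x \<in> bernstein_region rho" and y: "y \<in> bernstein_region rho" and uv: "0 \<le> u" "0 \<le> v" "u + v = 1"
  have *: "cmod (u *\<^sub>R x + v *\<^sub>R y - c) \<le> u * cmod (x - c) + v * cmod (y - c)" for c
  proof -
    have "u *\<^sub>R x + v *\<^sub>R y - c = u *\<^sub>R (x - c) + v *\<^sub>R (y - c)"
      using uv by (simp add: algebra_simps flip: scaleR_left_distrib)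
    then show ?thesis using uv norm_triangle_ineq[of "u *\<^sub>R (x - c)" "v *\<^sub>R (y - c)"] by simp
  qed
  have "cmod (u *\<^sub>R x + v *\<^sub>R y - 1) + cmod (u *\<^sub>R x + v *\<^sub>R y + 1)
     \<le> u * (cmod (x - 1) + cmod (x + 1)) + v * (cmod (y - 1) + cmod (y + 1))"
    using *[of 1] *[of "-1"] by (simp add: algebra_simps)
  also have "\<dots> \<le> u * (rho + 1 / rho) + v * (rho + 1 / rho)"
    using x y uv by (intro add_mono[OF mult_left_mono mult_left_mono]) (auto simp: bernstein_region_def)
  also have "\<dots> = rho + 1 / rho" using uv by (simp flip: distrib_right)
  finally show "u *\<^sub>R x + v *\<^sub>R y \<in> bernstein_region rho" by (simp add: bernstein_region_def)
qed

lemma two_less_add_inverse: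
  fixes rho :: real
  assumes "rho > 1"
  shows "rho + 1 / rho > 2"
proof -
  have "(rho - 1)\<^sup>2 / rho > 0" using assms by simp
  moreover have "(rho - 1)\<^sup>2 / rho = rho + 1 / rho - 2" using assms by (simp add: power2_eq_square field_simps)
  ultimately show ?thesis by simp
qed

lemma focal_sum_segment:
  assumes "x \<in> {-1..1::real}"
  shows "cmod (of_real x - 1) + cmod (of_real x + 1) = 2"
proof -
  have "complex_of_real x - 1 = of_real (x - 1)" "complex_of_real x + 1 = of_real (x + 1)" by simp_all
  then show ?thesis using assms by (simp only: norm_of_real) auto
qed

lemma segment_in_interior_bernstein_region:
  assumes "rho > 1" "x \<in> {-1..1::real}"
  shows "complex_of_real x \<in> interior (bernstein_region rho)"
proof (rule interiorI)
  show "open {z. cmod (z - 1) + cmod (z + 1) < rho + 1 / rho}"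
    by (intro open_Collect_less continuous_intros)
  show "complex_of_real x \<in> {z. cmod (z - 1) + cmod (z + 1) < rho + 1 / rho}"
    using focal_sum_segment[OF assms(2)] two_less_add_inverse[OF assms(1)] by simp
qed (auto simp: bernstein_region_def)

section \<open>The ellipse as a closed path\<close>

definition ellipse_param :: "real \<Rightarrow> real \<Rightarrow> complex" where
  "ellipse_param rho t = (of_real rho * cis (2 * pi * t) + of_real (1 / rho) * cis (- (2 * pi * t))) / 2"

text \<open>The inverse q = 1/u of the Joukowski variable u on the circle of radius rho; it is the
  small variable in all the expansions.\<close>

definition ellipse_nome :: "real \<Rightarrow> real \<Rightarrow> complex" where
  "ellipse_nome rho t = of_real (1 / rho) * cis (- (2 * pi * t))"

lemma ellipse_nome_inverse:
  assumes "rho > 1"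
  shows "1 / ellipse_nome rho t = of_real rho * cis (2 * pi * t)" "ellipse_nome rho t \<noteq> 0"
  using assms by (auto simp: ellipse_nome_def cis_inverse[symmetric] field_simps)

lemma ellipse_param_nome:
  assumes "rho > 1"
  shows "ellipse_param rho t = (1 / ellipse_nome rho t + ellipse_nome rho t) / 2"
  unfolding ellipse_nome_inverse(1)[OF assms] by (simp add: ellipse_param_def ellipse_nome_def)

lemma norm_ellipse_nome: "rho > 1 \<Longrightarrow> cmod (ellipse_nome rho t) = 1 / rho"
  by (simp add: ellipse_nome_def norm_mult norm_divide)

lemma ellipse_param_focal_sum:
  assumes "rho > 1"
  shows "cmod (ellipse_param rho t - 1) + cmod (ellipse_param rho t + 1) = rho + 1 / rho"
  using bernstein_region_sum[of rho "1 / ellipse_nome rho t"] assms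
  by (simp add: ellipse_param_nome norm_divide norm_ellipse_nome)

lemma ellipse_param_in_ellipse:
  assumes "t \<in> {0..1}"
  shows "ellipse_param rho t \<in> bernstein_ellipse rho"
  unfolding bernstein_ellipse_def ellipse_param_def
  using assms mult_left_mono[of t 1 "2 * pi"] by (intro image_eqI[of _ _ "2 * pi * t"]) auto

lemma bernstein_ellipse_subset:
  assumes "rho > 1"
  shows "bernstein_ellipse rho \<subseteq> bernstein_region rho"
proof
  fix z assume "z \<in> bernstein_ellipse rho"
  then obtain \<theta> where "z = (of_real rho * cis \<theta> + of_real (1 / rho) * cis (- \<theta>)) / 2"
    unfolding bernstein_ellipse_def by blast
  then have "z = ellipse_param rho (\<theta> / (2 * pi))" by (simp add: ellipse_param_def)
  then show "z \<in> bernstein_region rho"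
    using ellipse_param_focal_sum[OF assms] by (simp add: bernstein_region_def)
qed

lemma compact_bernstein_ellipse: "compact (bernstein_ellipse rho)"
  unfolding bernstein_ellipse_def by (intro compact_continuous_image continuous_intros compact_Icc) auto

lemma cis_has_vector_derivative:
  "((\<lambda>t. cis (c * t)) has_vector_derivative of_real c * \<i> * cis (c * t)) (at t within S)"
  unfolding has_vector_derivative_def
  by (auto intro!: derivative_eq_intros simp: fun_eq_iff scaleR_conv_of_real)

lemma ellipse_param_has_vector_derivative:
  assumes "rho > 1"
  shows "(ellipse_param rho has_vector_derivative
           2 * pi * \<i> * ((1 / ellipse_nome rho t - ellipse_nome rho t) / 2)) (at t within S)"
proof -
  have "((\<lambda>t. (of_real rho * cis (2 * pi * t) + of_real (1 / rho) * cis (- (2 * pi) * t)) / 2) has_vector_derivative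
      (of_real rho * (of_real (2 * pi) * \<i> * cis (2 * pi * t))
       + of_real (1 / rho) * (of_real (- (2 * pi)) * \<i> * cis (- (2 * pi) * t))) / 2) (at t within S)"
    by (intro has_vector_derivative_divide has_vector_derivative_add has_vector_derivative_mult_right
          cis_has_vector_derivative)
  then show ?thesis
    unfolding ellipse_nome_inverse(1)[OF assms]
    by (simp add: ellipse_param_def[abs_def] ellipse_nome_def algebra_simps)
qed

lemma continuous_on_ellipse_nome: "continuous_on S (ellipse_nome rho)"
  unfolding ellipse_nome_def by (intro continuous_intros)

lemma continuous_on_ellipse_param: "rho > 1 \<Longrightarrow> continuous_on S (ellipse_param rho)"
  unfolding ellipse_param_def by (intro continuous_intros) auto

lemma valid_path_ellipse_param:
  assumes "rho > 1"
  shows "valid_path (ellipse_param rho)"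
  unfolding valid_path_def
proof (rule C1_differentiable_imp_piecewise)
  show "ellipse_param rho C1_differentiable_on {0..1}"
    unfolding C1_differentiable_on_def
    using ellipse_param_has_vector_derivative[OF assms] ellipse_nome_inverse(2)[OF assms]
    by (intro exI[of _ "\<lambda>t. 2 * pi * \<i> * ((1 / ellipse_nome rho t - ellipse_nome rho t) / 2)"] conjI)
      (auto intro!: continuous_intros continuous_on_ellipse_nome)
qed

text \<open>In terms of q, z - x = (1 - 2 q x + q^2)/(2 q), and dz/(2 pi i) is (1 - q^2)/(2 q) dt.
  Cauchy's kernel thus becomes the Poisson kernel. The winding number stays as an unknown factor, to
  be determined from the case g = 1.\<close>

lemma ellipse_Cauchy_kernel:
  fixes g :: "complex \<Rightarrow> complex"
  assumes rho: "rho > 1" and x: "x \<in> {-1..1}" and g: "g holomorphic_on bernstein_region rho"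
  defines "w \<equiv> winding_number (ellipse_param rho) (of_real x)"
  defines "K \<equiv> \<lambda>q. (1 - q\<^sup>2) / (1 - 2 * q * of_real x + q\<^sup>2)"
  shows "((\<lambda>t. g (ellipse_param rho t) * K (ellipse_nome rho t)) has_integral w * g (of_real x)) {0..1}"
proof -
  have ne: "ellipse_param rho t \<noteq> of_real x" for t
    using ellipse_param_focal_sum[OF rho, of t] focal_sum_segment[OF x] two_less_add_inverse[OF rho] by auto
  have "((\<lambda>z. g z / (z - of_real x)) has_contour_integral (2 * pi * \<i> * w * g (of_real x))) (ellipse_param rho)"
    unfolding w_def
  proof (rule Cauchy_integral_formula_convex_simple[OF convex_bernstein_region g])
    show "path_image (ellipse_param rho) \<subseteq> bernstein_region rho - {of_real x}"
      using ne ellipse_param_focal_sum[OF rho] by (auto simp: path_image_def bernstein_region_def)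
    show "pathfinish (ellipse_param rho) = pathstart (ellipse_param rho)"
      by (simp add: pathfinish_def pathstart_def ellipse_param_def cis.ctr complex_eq_iff)
  qed (use rho x segment_in_interior_bernstein_region valid_path_ellipse_param in auto)
  then have "((\<lambda>t. g (ellipse_param rho t) / (ellipse_param rho t - of_real x) * vector_derivative (ellipse_param rho) (at t))
      has_integral (2 * pi * \<i> * w * g (of_real x))) {0..1}"
    unfolding has_contour_integral .
  from has_integral_mult_right[OF this, of "1 / (2 * pi * \<i>)"]
  have "((\<lambda>t. 1 / (2 * pi * \<i>) * (g (ellipse_param rho t) / (ellipse_param rho t - of_real x) * vector_derivative (ellipse_param rho) (at t)))
      has_integral (w * g (of_real x))) {0..1}"
    by simp
  moreover have "1 / (2 * pi * \<i>) * (g (ellipse_param rho t) / (ellipse_param rho t - of_real x) * vector_derivative (ellipse_param rho) (at t))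
     = g (ellipse_param rho t) * K (ellipse_nome rho t)" for t
  proof -
    define q where "q = ellipse_nome rho t"
    have q: "q \<noteq> 0" using ellipse_nome_inverse(2)[OF rho] by (simp add: q_def)
    have z: "ellipse_param rho t = (1 / q + q) / 2" using ellipse_param_nome[OF rho] by (simp add: q_def)
    have "(1 / q + q) / 2 - of_real x = (1 - 2 * q * of_real x + q\<^sup>2) / (2 * q)"
      using q by (simp add: field_simps power2_eq_square)
    moreover have "(1 / q - q) / 2 = (1 - q\<^sup>2) / (2 * q)"
      using q by (simp add: field_simps power2_eq_square)
    ultimately have "((1 / q - q) / 2) / ((1 / q + q) / 2 - of_real x)
        = ((1 - q\<^sup>2) / (2 * q)) / ((1 - 2 * q * of_real x + q\<^sup>2) / (2 * q))"
      by (simp only:)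
    also have "\<dots> = K q" unfolding K_def using q by (simp del: mult_eq_0_iff)
    finally have Kq: "((1 / q - q) / 2) / ((1 / q + q) / 2 - of_real x) = K q" .
    have vd: "vector_derivative (ellipse_param rho) (at t) = 2 * pi * \<i> * ((1 / q - q) / 2)"
      unfolding q_def by (rule vector_derivative_at) (rule ellipse_param_has_vector_derivative[OF rho])
    have cancel: "1 / c * (a / y * (c * d)) = a * (d / y)" if "c \<noteq> 0" for a c d y :: complex
      using that by simp
    show ?thesis
      unfolding z q_def[symmetric] vd Kq[symmetric] by (rule cancel) simp
  qed
  ultimately show ?thesis by simp
qed

lemma ellipse_nome_power_integral:
  assumes "rho > 1"
  shows "((\<lambda>t. ellipse_nome rho t ^ k) has_integral (if k = 0 then 1 else 0)) {0..1}"
proof (cases "k = 0")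
  case True
  then show ?thesis using has_integral_const_real[of "1::complex" 0 1] by simp
next
  case False
  define c where "c = - (2 * pi * real k)"
  have c: "c \<noteq> 0" using False by (simp add: c_def)
  have "((\<lambda>t. cis (c * t)) has_integral cis (c * 1) / (of_real c * \<i>) - cis (c * 0) / (of_real c * \<i>)) {0..1}"
  proof (rule fundamental_theorem_of_calculus)
    fix t :: real
    show "((\<lambda>t. cis (c * t) / (of_real c * \<i>)) has_vector_derivative cis (c * t)) (at t within {0..1})"
      using has_vector_derivative_divide[OF cis_has_vector_derivative, of c "of_real c * \<i>"] c by simp
  qed simp
  also have "cis (c * 1) = cis (c * 0)"
    using cis_multiple_2pi[of "- real k"] by (simp add: c_def mult_ac)
  finally have "((\<lambda>t. of_real ((1 / rho) ^ k) * cis (c * t)) has_integral of_real ((1 / rho) ^ k) * 0) {0..1}"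
    by (intro has_integral_mult_right) simp
  moreover have "ellipse_nome rho t ^ k = of_real ((1 / rho) ^ k) * cis (c * t)" for t
    unfolding ellipse_nome_def power_mult_distrib Complex.DeMoivre by (simp add: c_def mult_ac)
  ultimately show ?thesis using False by simp
qed

section \<open>Chebyshev expansion and the coefficient bound\<close>

lemma continuous_on_ellipse_compose:
  fixes f :: "complex \<Rightarrow> complex"
  assumes "rho > 1" "f holomorphic_on bernstein_region rho"
  shows "continuous_on S (\<lambda>t. f (ellipse_param rho t))"
proof (rule continuous_on_compose2[OF holomorphic_on_imp_continuous_on[OF assms(2)] continuous_on_ellipse_param[OF assms(1)]])
  show "ellipse_param rho ` S \<subseteq> bernstein_region rho"
    using ellipse_param_focal_sum[OF assms(1)] by (auto simp: bernstein_region_def)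
qed

text \<open>Chebyshev coefficients with the factor \<open>cheb_weight\<close> left out, written with
  powers of q so that the moment series can be summed under this integral.\<close>

definition cheb_coeff :: "(complex \<Rightarrow> complex) \<Rightarrow> real \<Rightarrow> nat \<Rightarrow> complex" where
  "cheb_coeff f rho k = integral {0..1} (\<lambda>t. f (ellipse_param rho t) * ellipse_nome rho t ^ k)"

lemma summable_cheb_majorant:
  fixes rho :: real
  assumes "rho > 1"
  shows "summable (\<lambda>k. C * (1 / rho) ^ k)"
  using assms by (intro summable_mult summable_geometric) auto

lemma norm_cheb_weight_term_le:
  assumes "rho > 1" "\<bar>a\<bar> \<le> C"
  shows "cmod (of_real (cheb_weight k * a) * ellipse_nome rho t ^ k) \<le> (2 * C) * (1 / rho) ^ k"
  using assms by (auto simp: norm_mult norm_power norm_ellipse_nome abs_mult cheb_weight_def intro!: mult_mono)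

text \<open>On the ellipse |q| = 1/rho for every t, so the Poisson series has a geometric majorant.
  It is applied with g = 1 for the winding number and with f along the ellipse for the
  expansion.\<close>

lemma cheb_kernel_sums:
  assumes rho: "rho > 1" and x: "x \<in> {-1..1}" and g: "continuous_on {0..1} g"
  defines "q \<equiv> ellipse_nome rho"
  shows "(\<lambda>k. integral {0..1} (\<lambda>t. g t * (of_real (cheb_weight k * cheb k x) * q t ^ k))) sums
           integral {0..1} (\<lambda>t. g t * ((1 - (q t)\<^sup>2) / (1 - 2 * q t * of_real x + (q t)\<^sup>2)))"
proof (rule sums_integral_dominated(1))
  show "(\<lambda>t. cmod (g t)) integrable_on {0..1}"
    using g by (intro integrable_continuous_real continuous_intros)
  show "(\<lambda>t. g t * (of_real (cheb_weight k * cheb k x) * q t ^ k)) integrable_on {0..1}" for k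
    unfolding q_def using g by (intro integrable_continuous_real continuous_intros continuous_on_ellipse_nome)
  show "cmod (of_real (cheb_weight k * cheb k x) * q t ^ k) \<le> (2 * 1) * (1 / rho) ^ k" for k t
    unfolding q_def by (intro norm_cheb_weight_term_le rho abs_cheb_le_1)
  show "summable (\<lambda>k. (2 * 1) * (1 / rho) ^ k)" by (rule summable_cheb_majorant[OF rho])
  show "(\<lambda>k. of_real (cheb_weight k * cheb k x) * q t ^ k) sums ((1 - (q t)\<^sup>2) / (1 - 2 * q t * of_real x + (q t)\<^sup>2))" for t
    unfolding q_def using rho x by (intro cheb_poisson_sums) (auto simp: norm_ellipse_nome)
qed

text \<open>The winding number is read off from the kernel series with \<open>g = 1\<close>: only its constant term survives integration.\<close>
lemma winding_number_ellipse_param: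
  assumes rho: "rho > 1" and x: "x \<in> {-1..1}"
  shows "winding_number (ellipse_param rho) (of_real x) = 1"
proof -
  have "(\<lambda>k. integral {0..1} (\<lambda>t. 1 * (of_real (cheb_weight k * cheb k x) * ellipse_nome rho t ^ k))) sums
      winding_number (ellipse_param rho) (of_real x)"
    using cheb_kernel_sums[OF rho x, of "\<lambda>_. 1"] integral_unique[OF ellipse_Cauchy_kernel[OF rho x, of "\<lambda>_. 1"]]
    by simp
  moreover have "integral {0..1} (\<lambda>t. 1 * (of_real (cheb_weight k * cheb k x) * ellipse_nome rho t ^ k))
      = (if k = 0 then (1::complex) else 0)" for k
    unfolding mult_1 integral_unique[OF has_integral_mult_right[OF ellipse_nome_power_integral[OF rho, of k]]]
    by (simp add: cheb_weight_def)
  ultimately have "(\<lambda>k. if k = 0 then 1 else 0) sums winding_number (ellipse_param rho) (of_real x)" by simp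
  then show ?thesis using sums_unique2 sums_single[of 0 "\<lambda>_. 1::complex"] by auto
qed

lemma cheb_expansion:
  assumes rho: "rho > 1" and x: "x \<in> {-1..1}" and f: "f holomorphic_on bernstein_region rho"
  shows "(\<lambda>k. of_real (cheb_weight k * cheb k x) * cheb_coeff f rho k) sums f (of_real x)"
proof -
  have "(\<lambda>k. integral {0..1} (\<lambda>t. f (ellipse_param rho t) * (of_real (cheb_weight k * cheb k x) * ellipse_nome rho t ^ k))) sums
      f (of_real x)"
    using cheb_kernel_sums[OF rho x continuous_on_ellipse_compose[OF rho f]]
      integral_unique[OF ellipse_Cauchy_kernel[OF rho x f]]
    by (simp add: winding_number_ellipse_param[OF rho x])
  moreover have "integral {0..1} (\<lambda>t. f (ellipse_param rho t) * (of_real (cheb_weight k * cheb k x) * ellipse_nome rho t ^ k))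
      = of_real (cheb_weight k * cheb k x) * cheb_coeff f rho k" for k
    unfolding cheb_coeff_def integral_mult_right[symmetric] by (simp only: mult.left_commute)
  ultimately show ?thesis by simp
qed

lemma norm_cheb_coeff_le:
  assumes rho: "rho > 1" and f: "f holomorphic_on bernstein_region rho"
    and M: "\<And>t. t \<in> {0..1} \<Longrightarrow> cmod (f (ellipse_param rho t)) \<le> M"
  shows "cmod (cheb_coeff f rho k) \<le> M * (1 / rho) ^ k"
proof -
  have "cmod (cheb_coeff f rho k) \<le> (M * (1 / rho) ^ k) * (1 - 0)"
    unfolding cheb_coeff_def
  proof (rule integral_bound)
    show "continuous_on {0..1} (\<lambda>t. f (ellipse_param rho t) * ellipse_nome rho t ^ k)"
      by (intro continuous_intros continuous_on_ellipse_nome continuous_on_ellipse_compose[OF rho f])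
    show "cmod (f (ellipse_param rho t) * ellipse_nome rho t ^ k) \<le> M * (1 / rho) ^ k" if "t \<in> {0..1}" for t
      using M[OF that] rho by (simp add: norm_mult norm_power norm_ellipse_nome divide_right_mono)
  qed simp
  then show ?thesis by simp
qed

text \<open>The point is uniformity in k: it gives the moment series a geometric majorant on the
  ellipse.\<close>

lemma abs_cheb_moment_le:
  assumes "lam > 0"
  shows "\<bar>cheb_moment lam n k\<bar> \<le> integral {-1..1} (\<lambda>x. gegenbauer_weight lam x * \<bar>gegenbauer n lam x\<bar>)"
proof -
  have "norm (cheb_moment lam n k) \<le> integral {-1..1} (\<lambda>x. gegenbauer_weight lam x * \<bar>gegenbauer n lam x\<bar>)"
    unfolding cheb_moment_def
  proof (rule integral_norm_bound_integral)
    fix x :: real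
    have "\<bar>gegenbauer n lam x * cheb k x\<bar> \<le> \<bar>gegenbauer n lam x\<bar>"
      using abs_cheb_le_1[of k x] by (simp add: abs_mult mult_left_le)
    then show "norm (gegenbauer_weight lam x * (gegenbauer n lam x * cheb k x)) \<le> gegenbauer_weight lam x * \<bar>gegenbauer n lam x\<bar>"
      using gegenbauer_weight_nonneg[of lam x] by (simp add: abs_mult[of "gegenbauer_weight lam x"] mult_left_mono)
  qed (use assms in \<open>auto intro!: weight_integrable continuous_intros\<close>)
  then show ?thesis by simp
qed

lemma gegenbauer_integral_sums:
  assumes rho: "rho > 1" and lam: "lam > 0" and f: "f holomorphic_on bernstein_region rho"
    and M: "\<And>t. t \<in> {0..1} \<Longrightarrow> cmod (f (ellipse_param rho t)) \<le> M"
  shows "(\<lambda>k. of_real (cheb_weight k * cheb_moment lam n k) * cheb_coeff f rho k) sums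
     integral {-1..1} (\<lambda>x. of_real (gegenbauer_weight lam x * gegenbauer n lam x) * f (of_real x))"
proof -
  have hi: "((\<lambda>x. of_real (gegenbauer_weight lam x * gegenbauer n lam x) * (of_real (cheb_weight k * cheb k x) * cheb_coeff f rho k))
     has_integral of_real (cheb_weight k * cheb_moment lam n k) * cheb_coeff f rho k) {-1..1}" for k
  proof -
    have "((\<lambda>x. gegenbauer_weight lam x * (gegenbauer n lam x * cheb k x)) has_integral cheb_moment lam n k) {-1..1}"
      unfolding cheb_moment_def using lam
      by (intro integrable_integral weight_integrable continuous_intros continuous_on_cheb)
    from has_integral_mult_left[OF has_integral_of_real[OF has_integral_mult_right[OF this, of "cheb_weight k"]], of "cheb_coeff f rho k"]
    show ?thesis by (simp add: mult_ac)
  qed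
  have "(\<lambda>k. integral {-1..1} (\<lambda>x. of_real (gegenbauer_weight lam x * gegenbauer n lam x) * (of_real (cheb_weight k * cheb k x) * cheb_coeff f rho k)))
    sums integral {-1..1} (\<lambda>x. of_real (gegenbauer_weight lam x * gegenbauer n lam x) * f (of_real x))"
  proof (rule sums_integral_dominated(1))
    show "(\<lambda>x. cmod (of_real (gegenbauer_weight lam x * gegenbauer n lam x))) integrable_on {-1..1}"
      using weight_integrable[OF lam, of "\<lambda>x. \<bar>gegenbauer n lam x\<bar>"]
      by (simp add: norm_mult abs_mult gegenbauer_weight_nonneg continuous_intros)
    show "cmod (of_real (cheb_weight k * cheb k x) * cheb_coeff f rho k) \<le> (2 * M) * (1 / rho) ^ k" for k x
    proof -
      have "\<bar>cheb_weight k * cheb k x\<bar> \<le> 2 * 1"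
        unfolding abs_mult using abs_cheb_le_1[of k x] by (intro mult_mono) (auto simp: cheb_weight_def)
      then have "cmod (of_real (cheb_weight k * cheb k x) * cheb_coeff f rho k) \<le> 2 * (M * (1 / rho) ^ k)"
        unfolding norm_mult norm_of_real using norm_cheb_coeff_le[OF rho f M, of k] by (intro mult_mono) auto
      then show ?thesis by simp
    qed
    show "summable (\<lambda>k. (2 * M) * (1 / rho) ^ k)" by (rule summable_cheb_majorant[OF rho])
  qed (use hi cheb_expansion[OF rho _ f] in auto)
  then show ?thesis unfolding integral_unique[OF hi] .
qed

text \<open>Here a and b are the semi-axes, and (1/q - q)/2 has real part b cos and imaginary part a
  sin. Its modulus is the speed of the ellipse divided by 2 pi.\<close>

lemma ellipse_speed_bound:
  assumes rho: "rho > 1"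
  defines "a \<equiv> (rho + 1 / rho) / 2" and "b \<equiv> (rho - 1 / rho) / 2"
  shows "cmod (1 - (ellipse_nome rho t)\<^sup>2)
    \<le> 2 / rho * (a * \<bar>sin (2 * pi * t)\<bar> + b * (1 - \<bar>sin (2 * pi * t)\<bar>))"
proof -
  define q where "q = ellipse_nome rho t"
  define s where "s = sin (2 * pi * t)"
  have q: "q \<noteq> 0" "1 / q = of_real rho * cis (2 * pi * t)"
    using ellipse_nome_inverse[OF rho] by (auto simp: q_def)
  have "1 - q\<^sup>2 = 2 * q * ((1 / q - q) / 2)" using q(1) by (simp add: field_simps power2_eq_square)
  also have "(1 / q - q) / 2 = Complex (b * cos (2 * pi * t)) (a * s)"
    unfolding q(2) using rho by (simp add: q_def ellipse_nome_def complex_eq_iff a_def b_def s_def field_simps)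
  also have "cmod (2 * q * \<dots>) = 2 / rho * sqrt (a\<^sup>2 * s\<^sup>2 + b\<^sup>2 * (1 - s\<^sup>2))"
  proof -
    have "cmod (Complex (b * cos (2 * pi * t)) (a * s)) = sqrt (a\<^sup>2 * s\<^sup>2 + b\<^sup>2 * (1 - s\<^sup>2))"
      by (simp add: cmod_def power_mult_distrib cos_squared_eq s_def add.commute)
    then show ?thesis
      unfolding norm_mult using rho by (simp add: q_def norm_ellipse_nome)
  qed
  also have "\<dots> \<le> 2 / rho * (a * \<bar>s\<bar> + b * (1 - \<bar>s\<bar>))"
  proof (intro mult_left_mono ellipse_speed_le)
    have "1 / rho < 1" using rho by simp
    then have "1 / rho \<le> rho" using rho by linarith
    then show "0 \<le> b" by (simp add: b_def)
  qed (use rho in \<open>auto simp: a_def b_def s_def field_simps\<close>)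
  finally show ?thesis by (simp add: q_def s_def)
qed

lemma integral_abs_sin: "((\<lambda>t. \<bar>sin (2 * pi * t)\<bar>) has_integral 2 / pi) {0..1}"
proof -
  define F where "F t = - cos (2 * pi * t) / (2 * pi)" for t :: real
  have F: "(F has_vector_derivative sin (2 * pi * t)) (at t within S)" for t S
    unfolding F_def has_real_derivative_iff_has_vector_derivative[symmetric]
    by (auto intro!: derivative_eq_intros)
  have "((\<lambda>t. sin (2 * pi * t)) has_integral F (1/2) - F 0) {0..1/2}"
    by (rule fundamental_theorem_of_calculus) (auto intro: F)
  then have 1: "((\<lambda>t. \<bar>sin (2 * pi * t)\<bar>) has_integral F (1/2) - F 0) {0..1/2}"
  proof (rule has_integral_eq[rotated])
    fix t :: real assume "t \<in> {0..1/2}"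
    then have "0 \<le> 2 * pi * t" "2 * pi * t \<le> pi" using mult_left_mono[of t "1/2" "2 * pi"] by auto
    then show "sin (2 * pi * t) = \<bar>sin (2 * pi * t)\<bar>" using sin_ge_zero by simp
  qed
  have "((\<lambda>t. - sin (2 * pi * t)) has_integral - F 1 - - F (1/2)) {1/2..1}"
    by (rule fundamental_theorem_of_calculus) (auto intro: F has_vector_derivative_minus)
  then have 2: "((\<lambda>t. \<bar>sin (2 * pi * t)\<bar>) has_integral - F 1 - - F (1/2)) {1/2..1}"
  proof (rule has_integral_eq[rotated])
    fix t :: real assume "t \<in> {1/2..1}"
    then have "pi \<le> 2 * pi * t" "2 * pi * t \<le> 2 * pi" using mult_left_mono[of "1/2" t "2 * pi"] by auto
    then have "sin (2 * pi * t - pi) \<ge> 0" by (intro sin_ge_zero) auto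
    then show "- sin (2 * pi * t) = \<bar>sin (2 * pi * t)\<bar>" by (simp add: sin_diff)
  qed
  have "((\<lambda>t. \<bar>sin (2 * pi * t)\<bar>) has_integral (F (1/2) - F 0) + (- F 1 - - F (1/2))) {0..1}"
    by (rule has_integral_combine[OF _ _ 1 2]) auto
  then show ?thesis by (simp add: F_def field_simps)
qed

text \<open>For the semi-axes a and b, 2 pi times this value is 4 a + 4 (pi/2 - 1) b, the bracket in
  \<open>Lambda_bound\<close>.\<close>

lemma ellipse_length_integral:
  "((\<lambda>t. a * \<bar>sin (2 * pi * t)\<bar> + b * (1 - \<bar>sin (2 * pi * t)\<bar>)) has_integral
     a * (2 / pi) + b * (1 - 2 / pi)) {0..1}"
  using has_integral_const_real[of "1::real" 0 1]
  by (intro has_integral_add has_integral_mult_right has_integral_diff integral_abs_sin) simp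

text \<open>The integral over [-1,1] is turned into one over the ellipse, of f times the generating
  function of the moments. That integrand is then bounded pointwise.\<close>

lemma norm_gegenbauer_integral_le:
  assumes rho: "rho > 1" and lam: "lam > 0" and n: "n \<ge> 1" and f: "f holomorphic_on bernstein_region rho"
    and M: "\<And>t. t \<in> {0..1} \<Longrightarrow> cmod (f (ellipse_param rho t)) \<le> M"
  defines "a \<equiv> (rho + 1 / rho) / 2" and "b \<equiv> (rho - 1 / rho) / 2"
  defines "c \<equiv> gegenbauer_norm n lam * gegenbauer_const lam n"
  shows "cmod (integral {-1..1} (\<lambda>x. of_real (gegenbauer_weight lam x * gegenbauer n lam x) * f (of_real x)))
     \<le> M * c * (1 / rho) ^ n * euler_factor lam (1 / rho\<^sup>2) * (2 / rho) * (a * (2 / pi) + b * (1 - 2 / pi))"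
    (is "cmod ?I \<le> _")
proof -
  define q where "q = ellipse_nome rho"
  define E where "E = euler_factor lam (1 / rho\<^sup>2)"
  have nq: "cmod (q t) = 1 / rho" for t using rho by (simp add: q_def norm_ellipse_nome)
  then have q1: "cmod (q t) < 1" for t using rho by simp
  have q2: "(cmod (q t))\<^sup>2 = 1 / rho\<^sup>2" for t using nq by (simp add: power_divide)
  \<comment> \<open>\<open>S\<close> is chosen separately for each t, so integrability of the
    product with \<open>?P\<close> is drawn from dominated convergence rather than from regularity
    of \<open>S\<close>.\<close>
  obtain S where S: "\<And>t. (\<lambda>k. of_real (cheb_weight k * cheb_moment lam n k) * q t ^ k) sums
              (of_real c * (q t ^ n * (1 - (q t)\<^sup>2) * S t))" "\<And>t. cmod (S t) \<le> E"
    using cheb_moment_series[OF lam n q1] unfolding c_def E_def q2 by metis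
  define m where "m = integral {-1..1} (\<lambda>x. gegenbauer_weight lam x * \<bar>gegenbauer n lam x\<bar>)"
  let ?P = "\<lambda>t. of_real c * (q t ^ n * (1 - (q t)\<^sup>2) * S t)"
  have c0: "c \<ge> 0"
    using lam by (auto simp: c_def gegenbauer_norm_def gegenbauer_const_def intro!: divide_nonneg_nonneg mult_nonneg_nonneg less_imp_le[OF Gamma_real_pos])
  have cont: "continuous_on {0..1} (\<lambda>t. f (ellipse_param rho t))"
    by (rule continuous_on_ellipse_compose[OF rho f])
  note dom = sums_integral_dominated[where W = "\<lambda>t. f (ellipse_param rho t)" and S = "{0..1}"
     and \<phi> = "\<lambda>k t. of_real (cheb_weight k * cheb_moment lam n k) * q t ^ k"
     and B = "\<lambda>k. (2 * m) * (1 / rho) ^ k" and \<Phi> = ?P, OF _ _ _ summable_cheb_majorant[OF rho] S(1)]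
  have prem: "(\<lambda>t. cmod (f (ellipse_param rho t))) integrable_on {0..1}"
     "\<And>k. (\<lambda>t. f (ellipse_param rho t) * (of_real (cheb_weight k * cheb_moment lam n k) * q t ^ k)) integrable_on {0..1}"
     "\<And>k t. cmod (of_real (cheb_weight k * cheb_moment lam n k) * q t ^ k) \<le> (2 * m) * (1 / rho) ^ k"
    unfolding q_def m_def using cont
    by (auto intro!: integrable_continuous_real continuous_intros continuous_on_ellipse_nome
         norm_cheb_weight_term_le[OF rho] abs_cheb_moment_le[OF lam] simp del: of_real_mult)
  have sums: "(\<lambda>k. integral {0..1} (\<lambda>t. f (ellipse_param rho t) * (of_real (cheb_weight k * cheb_moment lam n k) * q t ^ k)))
      sums integral {0..1} (\<lambda>t. f (ellipse_param rho t) * ?P t)"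
    by (rule dom(1)[OF prem])
  have int: "(\<lambda>t. f (ellipse_param rho t) * ?P t) integrable_on {0..1}"
    by (rule dom(2)[OF prem])
  have "integral {0..1} (\<lambda>t. f (ellipse_param rho t) * (of_real (cheb_weight k * cheb_moment lam n k) * q t ^ k))
     = of_real (cheb_weight k * cheb_moment lam n k) * cheb_coeff f rho k" for k
    unfolding cheb_coeff_def q_def integral_mult_right[symmetric] by (simp only: mult.left_commute)
  with sums have "(\<lambda>k. of_real (cheb_weight k * cheb_moment lam n k) * cheb_coeff f rho k)
      sums integral {0..1} (\<lambda>t. f (ellipse_param rho t) * ?P t)" by simp
  \<comment> \<open>The same series of moments times \<open>cheb_coeff\<close> sums to both
    integrals, so they coincide.\<close>
  then have I: "?I = integral {0..1} (\<lambda>t. f (ellipse_param rho t) * ?P t)"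
    using gegenbauer_integral_sums[OF rho lam f M] sums_unique2 by blast
  define K where "K = M * c * (1 / rho) ^ n * E * (2 / rho)"
  have "cmod ?I \<le> integral {0..1} (\<lambda>t. K * (a * \<bar>sin (2 * pi * t)\<bar> + b * (1 - \<bar>sin (2 * pi * t)\<bar>)))"
    unfolding I
  proof (rule integral_norm_bound_integral[OF int])
    show "(\<lambda>t. K * (a * \<bar>sin (2 * pi * t)\<bar> + b * (1 - \<bar>sin (2 * pi * t)\<bar>))) integrable_on {0..1}"
      using ellipse_length_integral by (intro integrable_on_mult_right) (auto simp: integrable_on_def)
    fix t :: real assume t: "t \<in> {0..1}"
    define v where "v = 2 / rho * (a * \<bar>sin (2 * pi * t)\<bar> + b * (1 - \<bar>sin (2 * pi * t)\<bar>))"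
    have v: "cmod (1 - (q t)\<^sup>2) \<le> v"
      unfolding v_def q_def a_def b_def by (rule ellipse_speed_bound[OF rho])
    then have v0: "v \<ge> 0" by (rule order_trans[OF norm_ge_zero])
    have M0: "M \<ge> 0" using M[OF t] by (rule order_trans[OF norm_ge_zero])
    have "cmod (f (ellipse_param rho t) * ?P t)
        = cmod (f (ellipse_param rho t)) * (c * ((1 / rho) ^ n * cmod (1 - (q t)\<^sup>2) * cmod (S t)))"
      using c0 by (simp add: norm_mult norm_power nq)
    also have "\<dots> \<le> M * (c * ((1 / rho) ^ n * v * E))"
      using M[OF t] S(2)[of t] v v0 M0 c0 rho by (intro mult_mono mult_nonneg_nonneg) auto
    also have "\<dots> = K * (a * \<bar>sin (2 * pi * t)\<bar> + b * (1 - \<bar>sin (2 * pi * t)\<bar>))"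
      by (simp add: K_def v_def mult_ac)
    finally show "cmod (f (ellipse_param rho t) * ?P t) \<le> K * (a * \<bar>sin (2 * pi * t)\<bar> + b * (1 - \<bar>sin (2 * pi * t)\<bar>))" .
  qed
  also have "\<dots> = K * (a * (2 / pi) + b * (1 - 2 / pi))"
    by (intro integral_unique has_integral_mult_right ellipse_length_integral)
  finally show ?thesis by (simp add: K_def E_def)
qed

theorem theorem4p3:
  fixes f :: "complex \<Rightarrow> complex" and rho lam M :: real and n :: nat
  assumes "rho > 1"
    and "f analytic_on bernstein_region rho"
    and "M = (SUP z\<in>bernstein_ellipse rho. cmod (f z))"
    and "lam > 0"
    and "n \<ge> 1"
  shows "cmod (gegenbauer_coeff f lam n) \<le>
           (if lam \<le> 1
            then Lambda_bound n rho lam M * (1 - 1 / rho\<^sup>2) powr (lam - 1)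
                   * real n powr (1 - lam) / rho ^ (n + 1)
            else Lambda_bound n rho lam M * (1 + 1 / rho\<^sup>2) powr (lam - 1)
                   * real n powr (1 - lam) / rho ^ (n + 1))"
proof -
  note rho = assms(1) and lam = assms(4) and n = assms(5)
  have f: "f holomorphic_on bernstein_region rho"
    using assms(2) by (rule analytic_imp_holomorphic)
  have "continuous_on (bernstein_ellipse rho) (\<lambda>z. cmod (f z))"
    using continuous_on_subset[OF holomorphic_on_imp_continuous_on[OF f] bernstein_ellipse_subset[OF rho]]
    by (intro continuous_intros)
  then have "bdd_above ((\<lambda>z. cmod (f z)) ` bernstein_ellipse rho)"
    by (intro bounded_imp_bdd_above compact_imp_bounded compact_continuous_image compact_bernstein_ellipse)
  \<comment> \<open>Boundedness on the compact ellipse is what makes the supremum an upper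
    bound.\<close>
  then have M: "cmod (f (ellipse_param rho t)) \<le> M" if "t \<in> {0..1}" for t
    unfolding assms(3) by (intro cSUP_upper ellipse_param_in_ellipse that)
  have M0: "M \<ge> 0" using M[of 0] by (simp add: order_trans[OF norm_ge_zero])
  define E where "E = euler_factor lam (1 / rho\<^sup>2)"
  define h where "h = gegenbauer_norm n lam"
  define L where "L = 2 * (rho + 1 / rho) + 2 * (pi / 2 - 1) * (rho - 1 / rho)"
  have h: "h > 0" using lam unfolding h_def gegenbauer_norm_def
    by (intro mult_pos_pos divide_pos_pos) (auto simp: power2_eq_square)
  have "1 / rho < 1" using rho by simp
  then have "rho - 1 / rho \<ge> 0" using rho by linarith
  then have L: "L \<ge> 0" unfolding L_def using rho pi_gt3 by (intro add_nonneg_nonneg mult_nonneg_nonneg) auto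
  have E: "E \<ge> 0" by (simp add: E_def euler_factor_nonneg)
  have "gegenbauer_coeff f lam n
     = integral {-1..1} (\<lambda>x. of_real (gegenbauer_weight lam x * gegenbauer n lam x) * f (of_real x)) / of_real h"
    by (simp add: gegenbauer_coeff_def gegenbauer_weight_def h_def)
  then have "cmod (gegenbauer_coeff f lam n)
     = cmod (integral {-1..1} (\<lambda>x. of_real (gegenbauer_weight lam x * gegenbauer n lam x) * f (of_real x))) / h"
    using h by (simp add: norm_divide)
  also have "\<dots> \<le> (M * (h * gegenbauer_const lam n) * (1 / rho) ^ n * E * (2 / rho)
      * ((rho + 1 / rho) / 2 * (2 / pi) + (rho - 1 / rho) / 2 * (1 - 2 / pi))) / h"
    using norm_gegenbauer_integral_le[OF rho lam n f M] h
    by (intro divide_right_mono) (auto simp: h_def E_def)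
  also have "\<dots> = gegenbauer_const lam n * (M * E * (1 / rho) ^ (n + 1)
      * (2 * ((rho + 1 / rho) / 2 * (2 / pi) + (rho - 1 / rho) / 2 * (1 - 2 / pi))))"
    using h rho by (simp add: power_divide mult_ac)
  also have "2 * ((rho + 1 / rho) / 2 * (2 / pi) + (rho - 1 / rho) / 2 * (1 - 2 / pi)) = L / pi"
    by (simp add: L_def diff_divide_distrib add_divide_distrib algebra_simps)
  also have "gegenbauer_const lam n * (M * E * (1 / rho) ^ (n + 1) * (L / pi))
      \<le> (Gamma lam * (Upsilon n 1 lam * real n powr (1 - lam))) * (M * E * (1 / rho) ^ (n + 1) * (L / pi))"
  proof (rule mult_right_mono)
    show "gegenbauer_const lam n \<le> Gamma lam * (Upsilon n 1 lam * real n powr (1 - lam))"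
      using mult_left_mono[OF Gamma_ratio_le_Upsilon[OF lam n], of "Gamma lam"] lam
      by (simp add: gegenbauer_const_def less_imp_le)
    show "0 \<le> M * E * (1 / rho) ^ (n + 1) * (L / pi)" using M0 E L rho by simp
  qed
  also have "\<dots> = Lambda_bound n rho lam M * E * real n powr (1 - lam) / rho ^ (n + 1)"
    unfolding Lambda_bound_def L_def[symmetric] by (simp add: power_divide mult_ac)
  \<comment> \<open>The two cases of the claim are those of \<open>euler_factor\<close> at
    1/rho^2.\<close>
  finally show ?thesis by (cases "lam \<le> 1") (simp_all add: E_def euler_factor_def)
qed

end
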